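(* Let $T:M\to M$ be a map, $V$ a Banach space, $\nu_0$ a reference probability measure and $P_0$ the Perron-Frobenius operator as in the REPFO setting of the context, and let $X:M\to\mathbb{R}$ be continuous. Let $z_{\max}:=\sup\{z\in\mathbb{R}:\nu_0(X\ge z)>0\}$, assumed finite, and $V_z:=\{X>z\}$. Assume that for some $z_0<z_{\max}$ the sets $A_\varepsilon:=V_{z_{\max}-\varepsilon}$, $\varepsilon\in E:=[0,z_{\max}-z_0]$, satisfy the assumptions of a REPFO setting, that $\nu_0(V_{z_{\max}})=0$, and that $\mu_0(A_\varepsilon)>0$ for $\varepsilon>0$ and the limits $q_k:=\lim_{\varepsilon\to0}q_{k,\varepsilon}$ exist for all $k\ge0$ (with $\mu_0$ and $q_{k,\varepsilon}$ as in the context). Put $\theta:=1-\sum_{k=0}^\infty q_k$. Fix $t>0$ and let $z_n\in[z_0,z_{\max}]$ be real numbers such that $$\lim_{n\to\infty}n\,\mu_0\{X>z_n\}=t.$$ Let $X_n:=X\circ T^n$ for $n\ge0$, considered as a process on the probability space $(M,\mathcal{B},\nu_0)$. Then $$\lim_{n\to\infty}\nu_0\{\max(X_0,\dots,X_{n-1})\le z_n\}=e^{-t\theta}.$$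
   Context: Notation. $\mathcal{B}$ is the Borel $\sigma$-algebra of $M$. For $\varphi\in V$ and a bounded linear functional $\nu$ on $V$, $\varphi\otimes\nu$ is the operator $f\mapsto\nu(f)\varphi$. For an operator $R$ on $V$, $\nu R$ denotes the functional $\nu\circ R$. REPFO setting (rare event Perron-Frobenius operators). $E$ is a topological space of parameters containing a distinguished point $0$ (here $E=[0,z_{\max}-z_0]$). $(V,\|\cdot\|)$ is a complex Banach space of functions or distributions on a metric space $M$ that contains the constant functions. $T:M\to M$ is a (measurable) map, $\nu_0$ is a reference probability measure on $M$, which also acts as a bounded linear functional on $V$ (for functions, $\nu_0(f)=\int f\,d\nu_0$). $P_0:V\to V$ is the Perron-Frobenius operator of $T$ with respect to $\nu_0$, i.e. $\nu_0\big((P_0f)\cdot g\big)=\nu_0\big(f\cdot (g\circ T)\big)$ for $f\in V$ and bounded measurable $g$ (for which the products make sense); in particular $\nu_0P_0=\nu_0$. $P_0$ is mixing in the following sense: (Mix) $P_0=\varphi_0\otimes\nu_0+Q_0$ with $\varphi_0\in V$, $P_0\varphi_0=\varphi_0$, $\nu_0P_0=\nu_0$, $Q_0\varphi_0=0$, $\nu_0Q_0=0$ (hence $\nu_0(\varphi_0)=1$), and $Q_0$ has spectral radius strictly smaller than $1$. $(A_\varepsilon)_{\varepsilon\in E}$ is a family of subsets of $M$, and for $\varepsilon\in E\setminus\{0\}$ the operator $P_\varepsilon$ is $P_\varepsilon f=P_0(1_{M\setminus A_\varepsilon}f)$ (at the parameter $\varepsilon=0$ the operator is $P_0$ itself, $A_0$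 being negligible). The following are assumed: (i) There are constants $\alpha\in(0,1)$, $D>0$ and a second norm (or only a seminorm) $|\cdot|_w\le\|\cdot\|$ on $V$ such that - for each $\varepsilon\in E$ the residual spectrum of $P_\varepsilon$ is contained in $\{z\in\mathbb{C}:|z|\le\alpha\}$; - $|P_\varepsilon^nf|_w\le D|f|_w$ for all $\varepsilon\in E$, $f\in V$, $n\in\mathbb{N}$; - $\|P_\varepsilon^nf\|\le D\alpha^n\|f\|+D|f|_w$ for all $\varepsilon\in E$, $f\in V$, $n\in\mathbb{N}$; - there is a monotone upper semi-continuous function $\pi:E\to[0,\infty)$, $\varepsilon\mapsto\pi_\varepsilon$, with $\lim_{\varepsilon\to0}\pi_\varepsilon=0$ and $|P_\varepsilon f-P_0f|_w\le\pi_\varepsilon\|f\|$ for all $f\in V$, $\varepsilon\in E$. (ii) $1_{A_\varepsilon}\cdot f\in V$ for all $f\in V$ and $\varepsilon\in E$. (iii) There is a constant $K_0$ such that $|\nu_0(1_{A_\varepsilon}f)|\cdot\|1_{A_\varepsilon}\varphi_0\|\le K_0\,\|f\|\cdot|\nu_0(1_{A_\varepsilon}\varphi_0)|$ for all $f\in V$, $\varepsilon\in E$. Derived objects. $\mu_0$ is the $T$-invariant probability measure $\mu_0(A)=\int_A\varphi_0\,d\nu_0$. For $k\ge0$ and $\varepsilon$ with $\mu_0(A_\varepsilon)>0$, $$q_{k,\varepsilon}:=\frac{\mu_0\big(A_\varepsilon\cap T^{-1}A_\varepsilon^c\cap\dots\cap T^{-k}A_\varepsilon^c\cap T^{-(k+1)}A_\varepsilon\big)}{\mu_0(A_\varepsilon)},$$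 where $A_\varepsilon^c=M\setminus A_\varepsilon$ (for $k=0$ the numerator is $\mu_0(A_\varepsilon\cap T^{-1}A_\varepsilon)$). The number $\theta$ is called the extremal index. *)

theory Defs
  imports "HOL-Probability.Probability_Measure"
begin

section \<open>Complex Banach spaces and spectra\<close>

text \<open>The library has real Banach spaces only. As \<open>norm_scaleC\<close> and \<open>scaleC_of_real\<close> make the
  complex and the real structure agree, completeness in the sense of \<open>banach\<close> is the usual one.\<close>

class complex_banach = banach +
  fixes scaleC :: "complex \<Rightarrow> 'a \<Rightarrow> 'a"  (infixr "*\<^sub>C" 75)
  assumes scaleC_add_right: "a *\<^sub>C (x + y) = a *\<^sub>C x + a *\<^sub>C y"
    and scaleC_add_left: "(a + b) *\<^sub>C x = a *\<^sub>C x + b *\<^sub>C x"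
    and scaleC_scaleC: "a *\<^sub>C (b *\<^sub>C x) = (a * b) *\<^sub>C x"
    and scaleC_of_real: "complex_of_real r *\<^sub>C x = r *\<^sub>R x"
    and norm_scaleC: "norm (a *\<^sub>C x) = cmod a * norm x"

instantiation complex :: complex_banach
begin
definition scaleC_complex :: "complex \<Rightarrow> complex \<Rightarrow> complex"
  where "scaleC_complex a x = a * x"
instance
  by standard (auto simp: scaleC_complex_def algebra_simps scaleR_conv_of_real norm_mult)
end

definition clinear :: "('a::complex_banach \<Rightarrow> 'b::complex_banach) \<Rightarrow> bool"
  where "clinear S \<longleftrightarrow> (\<forall>x y. S (x + y) = S x + S y) \<and> (\<forall>c x. S (c *\<^sub>C x) = c *\<^sub>C S x)"

definition bounded_clinear :: "('a::complex_banach \<Rightarrow> 'b::complex_banach) \<Rightarrow> bool"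
  where "bounded_clinear S \<longleftrightarrow> clinear S \<and> (\<exists>K. \<forall>x. norm (S x) \<le> K * norm x)"

definition spectrum :: "('v::complex_banach \<Rightarrow> 'v) \<Rightarrow> complex set"
  where "spectrum S = {z. \<not> (\<exists>R. bounded_clinear R \<and>
           (\<forall>f. R (z *\<^sub>C f - S f) = f) \<and> (\<forall>f. z *\<^sub>C R f - S (R f) = f))}"

text \<open>The supremum is the usual one for bounded \<open>S\<close> on a nonzero space, where the spectrum is
  nonempty and bounded.\<close>

definition spectral_radius :: "('v::complex_banach \<Rightarrow> 'v) \<Rightarrow> real"
  where "spectral_radius S = Sup (cmod ` spectrum S)"

definition residual_spectrum :: "('v::complex_banach \<Rightarrow> 'v) \<Rightarrow> complex set"
  where "residual_spectrum S =
           {z. inj (\<lambda>f. z *\<^sub>C f - S f) \<and> closure (range (\<lambda>f. z *\<^sub>C f - S f)) \<noteq> UNIV}"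

definition cseminorm :: "('v::complex_banach \<Rightarrow> real) \<Rightarrow> bool"
  where "cseminorm p \<longleftrightarrow> (\<forall>f. 0 \<le> p f) \<and> (\<forall>f g. p (f + g) \<le> p f + p g) \<and>
           (\<forall>c f. p (c *\<^sub>C f) = cmod c * p f)"

definition upper_semicontinuous_on :: "'a::topological_space set \<Rightarrow> ('a \<Rightarrow> real) \<Rightarrow> bool"
  where "upper_semicontinuous_on E h \<longleftrightarrow>
           (\<forall>x\<in>E. \<forall>c. h x < c \<longrightarrow> (\<forall>\<^sub>F y in at x within E. h y < c))"


section \<open>Perron-Frobenius operators on spaces of functions or distributions\<close>

text \<open>
  The elements of \<open>V\<close> (the type \<^typ>\<open>'v\<close>) are functions or distributions on \<open>M\<close> (the type
  \<^typ>\<open>'m\<close>). Both are handled through the number \<open>pair f g\<close>, which stands for \<open>\<nu>\<^sub>0(f \<cdot> g)\<close>.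
  The set \<open>\<Phi>\<close> consists of bounded measurable functions \<open>g\<close> for which these products make sense.
  For functions, i.e. \<open>V\<close> contained in \<open>L\<^sup>1(\<nu>\<^sub>0)\<close>, one takes for \<open>\<Phi>\<close> all bounded Borel functions
  and for \<open>pair f g\<close> the integral of \<open>f \<cdot> g\<close>; for distributions \<open>\<Phi>\<close> is a smaller space.
  The functional \<open>\<nu>\<^sub>0\<close> on \<open>V\<close> is \<open>f \<mapsto> pair f 1\<close>. The vector \<open>one\<close> is the constant function \<open>1\<close> as an
  element of \<open>V\<close>; its multiples are the other constants. It is not required that \<open>f\<close> be determined
  by the numbers \<open>pair f g\<close>, so spaces of functions that are not identified \<open>\<nu>\<^sub>0\<close>-almost
  everywhere are included.
\<close>

definition functional_of :: "('v \<Rightarrow> ('m \<Rightarrow> complex) \<Rightarrow> complex) \<Rightarrow> 'v \<Rightarrow> complex"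
  where "functional_of pair f = pair f (\<lambda>_. 1)"

locale perron_frobenius =
  fixes T :: "'m::metric_space \<Rightarrow> 'm"
    and \<nu>\<^sub>0 :: "'m measure"
    and \<Phi> :: "('m \<Rightarrow> complex) set"
    and pair :: "'v::complex_banach \<Rightarrow> ('m \<Rightarrow> complex) \<Rightarrow> complex"
    and one :: 'v
    and P\<^sub>0 :: "'v \<Rightarrow> 'v"
  assumes T_measurable: "T \<in> borel \<rightarrow>\<^sub>M borel"
    and prob_nu0: "prob_space \<nu>\<^sub>0"
    and sets_nu0: "sets \<nu>\<^sub>0 = sets borel"
    and Phi_measurable: "\<And>g. g \<in> \<Phi> \<Longrightarrow> g \<in> borel_measurable borel"
    and Phi_bounded: "\<And>g. g \<in> \<Phi> \<Longrightarrow> bounded (range g)"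
    and Phi_one: "(\<lambda>_. 1) \<in> \<Phi>"
    and Phi_add: "\<And>g h. g \<in> \<Phi> \<Longrightarrow> h \<in> \<Phi> \<Longrightarrow> (\<lambda>x. g x + h x) \<in> \<Phi>"
    and Phi_scale: "\<And>c g. g \<in> \<Phi> \<Longrightarrow> (\<lambda>x. c * g x) \<in> \<Phi>"
    and Phi_comp: "\<And>g. g \<in> \<Phi> \<Longrightarrow> g \<circ> T \<in> \<Phi>"
    and pair_clinear: "\<And>g. g \<in> \<Phi> \<Longrightarrow> clinear (\<lambda>f. pair f g)"
    and pair_add: "\<And>f g h. g \<in> \<Phi> \<Longrightarrow> h \<in> \<Phi> \<Longrightarrow> pair f (\<lambda>x. g x + h x) = pair f g + pair f h"
    and pair_scale: "\<And>f c g. g \<in> \<Phi> \<Longrightarrow> pair f (\<lambda>x. c * g x) = c * pair f g"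
    and nu0_bounded: "bounded_clinear (functional_of pair)"
    and pair_one: "\<And>g. g \<in> \<Phi> \<Longrightarrow> pair one g = (LINT x|\<nu>\<^sub>0. g x)"
    and P0_bounded: "bounded_clinear P\<^sub>0"
    and P0_transfer: "\<And>f g. g \<in> \<Phi> \<Longrightarrow> pair (P\<^sub>0 f) g = pair f (g \<circ> T)"

text \<open>The decomposition (Mix), and the invariant measure \<open>\<mu>\<^sub>0(B) = \<integral>\<^sub>B \<phi>\<^sub>0 d\<nu>\<^sub>0 = \<nu>\<^sub>0(\<phi>\<^sub>0 \<cdot> 1\<^sub>B)\<close>.\<close>

locale mixing_perron_frobenius = perron_frobenius T \<nu>\<^sub>0 \<Phi> pair one P\<^sub>0
  for T :: "'m::metric_space \<Rightarrow> 'm" and \<nu>\<^sub>0 \<Phi>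
    and pair :: "'v::complex_banach \<Rightarrow> ('m \<Rightarrow> complex) \<Rightarrow> complex" and one P\<^sub>0 +
  fixes \<phi>\<^sub>0 :: 'v
    and Q\<^sub>0 :: "'v \<Rightarrow> 'v"
    and \<mu>\<^sub>0 :: "'m measure"
  assumes P0_decomp: "\<And>f. P\<^sub>0 f = functional_of pair f *\<^sub>C \<phi>\<^sub>0 + Q\<^sub>0 f"
    and Q0_bounded: "bounded_clinear Q\<^sub>0"
    and P0_phi0: "P\<^sub>0 \<phi>\<^sub>0 = \<phi>\<^sub>0"
    and nu0_P0: "\<And>f. functional_of pair (P\<^sub>0 f) = functional_of pair f"
    and Q0_phi0: "Q\<^sub>0 \<phi>\<^sub>0 = 0"
    and nu0_Q0: "\<And>f. functional_of pair (Q\<^sub>0 f) = 0"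
    and Q0_radius: "spectral_radius Q\<^sub>0 < 1"
    and prob_mu0: "prob_space \<mu>\<^sub>0"
    and sets_mu0: "sets \<mu>\<^sub>0 = sets borel"
    and mu0_invariant: "distr \<mu>\<^sub>0 borel T = \<mu>\<^sub>0"
    and mu0_density: "\<And>B. B \<in> sets borel \<Longrightarrow> indicator B \<in> \<Phi> \<Longrightarrow>
                        pair \<phi>\<^sub>0 (indicator B) = complex_of_real (measure \<mu>\<^sub>0 B)"


section \<open>Rare event Perron-Frobenius operators\<close>

text \<open>The map \<open>mult_ind B\<close> is multiplication with the indicator function of \<open>B\<close>.
  Hence \<open>f - mult_ind B f\<close> is the product of \<open>f\<close> with the indicator function of the complement.\<close>

definition rare_op :: "('v::complex_banach \<Rightarrow> 'v) \<Rightarrow> ('m set \<Rightarrow> 'v \<Rightarrow> 'v) \<Rightarrow> (real \<Rightarrow> 'm set) \<Rightarrow>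
    real \<Rightarrow> 'v \<Rightarrow> 'v"
  where "rare_op P\<^sub>0 mult_ind A \<epsilon> = (if \<epsilon> = 0 then P\<^sub>0 else (\<lambda>f. P\<^sub>0 (f - mult_ind (A \<epsilon>) f)))"

text \<open>The assumption \<open>uniform_estimates\<close> is (i), \<open>mult_clinear\<close>, \<open>Phi_mult\<close> and \<open>pair_mult\<close> give (ii)
  its meaning (\<open>mult_ind (A \<epsilon>)\<close> maps \<open>V\<close> to \<open>V\<close> by its type), and \<open>rare_bound\<close> is (iii).\<close>

locale REPFO = mixing_perron_frobenius T \<nu>\<^sub>0 \<Phi> pair one P\<^sub>0 \<phi>\<^sub>0 Q\<^sub>0 \<mu>\<^sub>0
  for T :: "'m::metric_space \<Rightarrow> 'm" and \<nu>\<^sub>0 \<Phi>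
    and pair :: "'v::complex_banach \<Rightarrow> ('m \<Rightarrow> complex) \<Rightarrow> complex" and one P\<^sub>0 \<phi>\<^sub>0 Q\<^sub>0 \<mu>\<^sub>0 +
  fixes mult_ind :: "'m set \<Rightarrow> 'v \<Rightarrow> 'v"
    and E :: "real set"
    and A :: "real \<Rightarrow> 'm set"
  assumes zero_in_E: "0 \<in> E"
    and uniform_estimates:
      "\<exists>\<alpha> D wnorm \<pi>. 0 < \<alpha> \<and> \<alpha> < 1 \<and> 0 < D \<and>
         cseminorm wnorm \<and> (\<forall>f. wnorm f \<le> norm f) \<and>
         (\<forall>\<epsilon>\<in>E. residual_spectrum (rare_op P\<^sub>0 mult_ind A \<epsilon>) \<subseteq> {z. cmod z \<le> \<alpha>}) \<and>
         (\<forall>\<epsilon>\<in>E. \<forall>f. \<forall>n::nat. wnorm ((rare_op P\<^sub>0 mult_ind A \<epsilon> ^^ n) f) \<le> D * wnorm f) \<and>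
         (\<forall>\<epsilon>\<in>E. \<forall>f. \<forall>n::nat. norm ((rare_op P\<^sub>0 mult_ind A \<epsilon> ^^ n) f) \<le> D * \<alpha> ^ n * norm f + D * wnorm f) \<and>
         (\<forall>\<epsilon>\<in>E. 0 \<le> \<pi> \<epsilon>) \<and> mono_on E \<pi> \<and> upper_semicontinuous_on E \<pi> \<and>
         (\<pi> \<longlongrightarrow> 0) (at 0 within E) \<and>
         (\<forall>\<epsilon>\<in>E. \<forall>f. wnorm (rare_op P\<^sub>0 mult_ind A \<epsilon> f - P\<^sub>0 f) \<le> \<pi> \<epsilon> * norm f)"
    and mult_clinear: "\<And>\<epsilon>. \<epsilon> \<in> E \<Longrightarrow> clinear (mult_ind (A \<epsilon>))"
    and Phi_mult: "\<And>\<epsilon> g. \<epsilon> \<in> E \<Longrightarrow> g \<in> \<Phi> \<Longrightarrow> (\<lambda>x. indicator (A \<epsilon>) x * g x) \<in> \<Phi>"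
    and pair_mult: "\<And>\<epsilon> f g. \<epsilon> \<in> E \<Longrightarrow> g \<in> \<Phi> \<Longrightarrow>
                      pair (mult_ind (A \<epsilon>) f) g = pair f (\<lambda>x. indicator (A \<epsilon>) x * g x)"
    and rare_bound:
      "\<exists>K\<^sub>0. \<forall>f. \<forall>\<epsilon>\<in>E. cmod (functional_of pair (mult_ind (A \<epsilon>) f)) * norm (mult_ind (A \<epsilon>) \<phi>\<^sub>0)
                      \<le> K\<^sub>0 * norm f * cmod (functional_of pair (mult_ind (A \<epsilon>) \<phi>\<^sub>0))"

text \<open>The numbers \<open>q\<^sub>k\<^sub>,\<^sub>\<epsilon>\<close>: conditional probability given \<open>B = A\<^sub>\<epsilon>\<close> that the first return to \<open>B\<close>
  happens at time \<open>k + 1\<close>.\<close>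

definition return_ratio :: "('m \<Rightarrow> 'm) \<Rightarrow> 'm measure \<Rightarrow> 'm set \<Rightarrow> nat \<Rightarrow> real"
  where "return_ratio T \<mu> B k =
           measure \<mu> {x \<in> B. (\<forall>j\<in>{1..k}. (T ^^ j) x \<notin> B) \<and> (T ^^ (k + 1)) x \<in> B} / measure \<mu> B"

end

theory Submission
  imports Defs
begin

text \<open>
  With \<open>A = {X > z n}\<close>, \<open>\<epsilon> = zmax - z n\<close> and \<open>P\<^sub>\<epsilon> f = P\<^sub>0(f - 1\<^sub>A f)\<close>, duality identifies the probability
  \<open>\<nu>\<^sub>0{max(X\<^sub>0, \<dots>, X\<^sub>n\<^sub>-\<^sub>1) \<le> z n}\<close> with \<open>\<nu>\<^sub>0(P\<^sub>\<epsilon>\<^sup>n 1)\<close>: the mass that has not entered \<open>A\<close> before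
  time \<open>n\<close>. The proof shows that at each step a fraction close to \<open>\<theta> \<Delta>\<close> of this mass is lost, where
  \<open>\<Delta> = \<mu>\<^sub>0(A)\<close>. As \<open>n \<Delta> \<longlonglongrightarrow> t\<close>, what remains is close to \<open>(1 - \<theta> \<Delta>)\<^sup>n\<close>, that is to
  \<open>exp (- t \<theta>)\<close>.

  No eigenvalue or eigenvector of \<open>P\<^sub>\<epsilon>\<close> is needed for this. Vectors \<open>f\<close> are split into \<open>\<nu>\<^sub>0(f) \<phi>\<^sub>0\<close> and a
  centred part. The spectral radius of \<open>Q\<^sub>0\<close> makes \<open>P\<^sub>0\<^sup>n\<close> decay on the kernel of \<open>\<nu>\<^sub>0\<close>
  (\<open>power_decay\<close>), and the two-norm estimates transfer this to \<open>P\<^sub>\<epsilon>\<close>: for a fixed large \<open>m\<close>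
  and all small \<open>\<epsilon>\<close>, \<open>P\<^sub>\<epsilon>\<^sup>m\<close> contracts the kernel of \<open>\<nu>\<^sub>0\<close> (\<open>contraction_on_kernel\<close>). On the other hand
  \<open>P\<^sub>\<epsilon> \<phi>\<^sub>0\<close> differs from \<open>\<phi>\<^sub>0\<close> only by \<open>P\<^sub>0(1\<^sub>A \<phi>\<^sub>0)\<close>. Together these show that the centred part of
  \<open>P\<^sub>\<epsilon>\<^sup>n \<phi>\<^sub>0\<close> is of the size of \<open>1\<^sub>A \<phi>\<^sub>0\<close>, uniformly in \<open>n\<close> (\<open>centered_part_uniformly_small\<close>). This is
  exactly the size on which the assumption on rare events bounds \<open>f \<mapsto> \<nu>\<^sub>0(1\<^sub>A f)\<close> by a multiple of \<open>\<Delta>\<close>.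

  Let \<open>a\<^sub>n = \<nu>\<^sub>0(P\<^sub>\<epsilon>\<^sup>n \<phi>\<^sub>0)\<close> be the survival probability under \<open>\<mu>\<^sub>0\<close>. The loss at time \<open>n\<close> is
  \<open>\<nu>\<^sub>0(1\<^sub>A P\<^sub>\<epsilon>\<^sup>n \<phi>\<^sub>0)\<close>. Writing \<open>P\<^sub>\<epsilon>\<^sup>n = P\<^sub>\<epsilon>\<^sup>k P\<^sub>\<epsilon>\<^sup>n\<^sup>-\<^sup>k\<close> and letting \<open>P\<^sub>\<epsilon>\<^sup>k\<close> contract the centred part, it equals
  \<open>a\<^sub>n\<^sub>-\<^sub>k \<nu>\<^sub>0(1\<^sub>A P\<^sub>\<epsilon>\<^sup>k \<phi>\<^sub>0)\<close> up to a small multiple of \<open>\<Delta>\<close> (\<open>hitting_factorises\<close>). Since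
  \<open>P\<^sub>\<epsilon> \<phi>\<^sub>0 = \<phi>\<^sub>0 - P\<^sub>0(1\<^sub>A \<phi>\<^sub>0)\<close>, a telescoping sum gives
  \<open>\<nu>\<^sub>0(1\<^sub>A P\<^sub>\<epsilon>\<^sup>k \<phi>\<^sub>0) = \<Delta> (1 - (\<Sum>j<k. q\<^sub>j\<^sub>,\<^sub>\<epsilon>))\<close> (\<open>hitting_eq_return_ratios\<close>), which is how the extremal
  index enters. Finally \<open>a\<^sub>n\<^sub>-\<^sub>k\<close> and \<open>a\<^sub>n\<close> differ by at most \<open>k \<Delta>\<close>, and the passage from \<open>\<mu>\<^sub>0\<close> to \<open>\<nu>\<^sub>0\<close>
  costs nothing in the limit because \<open>1 - \<phi>\<^sub>0\<close> lies in the kernel of \<open>\<nu>\<^sub>0\<close>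
  (\<open>initial_measure_forgotten\<close>).
\<close>


section \<open>Linear operators on complex Banach spaces\<close>

lemma scaleC_one [simp]: "1 *\<^sub>C x = x" for x :: "'a::complex_banach"
  using scaleC_of_real[of 1 x] by simp

lemma scaleC_zero_left [simp]: "0 *\<^sub>C x = 0" for x :: "'a::complex_banach"
  using scaleC_of_real[of 0 x] by simp

lemma linear_scaleC_right: "linear (\<lambda>x. c *\<^sub>C x)" for c :: complex
proof (rule linearI)
  show "c *\<^sub>C (r *\<^sub>R x) = r *\<^sub>R c *\<^sub>C x" for r and x :: "'a::complex_banach"
    by (simp flip: scaleC_of_real add: scaleC_scaleC mult.commute)
qed (simp add: scaleC_add_right)

lemma linear_scaleC_left: "linear (\<lambda>c. c *\<^sub>C x)" for x :: "'a::complex_banach"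
  by (rule linearI) (simp_all add: scaleC_add_left scaleR_conv_of_real flip: scaleC_scaleC scaleC_of_real)

lemmas scaleC_sum_right = linear_sum[OF linear_scaleC_right]
lemmas scaleC_sum_left = linear_sum[OF linear_scaleC_left]
lemmas scaleC_diff_right = linear_diff[OF linear_scaleC_right]
lemmas scaleC_diff_left = linear_diff[OF linear_scaleC_left]

lemma clinear_imp_linear: "clinear S \<Longrightarrow> linear S"
  by (rule linearI) (simp_all add: clinear_def flip: scaleC_of_real)

lemma clinear_scaleC: "clinear S \<Longrightarrow> S (c *\<^sub>C x) = c *\<^sub>C S x"
  by (simp add: clinear_def)

lemma linear_funpow: "linear S \<Longrightarrow> linear (S ^^ n)" for S :: "'a::real_vector \<Rightarrow> 'a"
  by (induction n) (auto simp: linear_compose linear_id)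

lemma bounded_clinear_pos_bound:
  assumes "bounded_clinear S"
  obtains K where "0 < K" "\<And>x. norm (S x) \<le> K * norm x"
proof -
  obtain K where K: "\<And>x. norm (S x) \<le> K * norm x"
    using assms by (auto simp: bounded_clinear_def)
  have "norm (S x) \<le> max K 1 * norm x" for x
    by (rule order_trans[OF K]) (simp add: mult_right_mono)
  then show ?thesis by (intro that[of "max K 1"]) auto
qed


section \<open>Decay of powers of an operator with small spectral radius\<close>

text \<open>Outside the disc of radius \<open>\<parallel>S\<parallel>\<close> the equation \<open>z x - S x = f\<close> is a contractive fixed point
  problem. The lemma guarantees that the supremum in the definition of the spectral radius is an
  upper bound of the spectrum.\<close>

lemma spectrum_bounded:
  fixes S :: "'v::complex_banach \<Rightarrow> 'v"
  assumes S: "bounded_clinear S"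
  shows "bdd_above (cmod ` spectrum S)"
proof -
  obtain K where K: "0 < K" "\<And>x. norm (S x) \<le> K * norm x"
    by (rule bounded_clinear_pos_bound[OF S]) blast
  have cl: "clinear S" and lin: "linear S"
    using S clinear_imp_linear by (auto simp: bounded_clinear_def)
  have "z \<notin> spectrum S" if z: "K < cmod z" for z
  proof -
    have z0: "z \<noteq> 0" using z K(1) by auto
    have lower: "(cmod z - K) * norm x \<le> norm (z *\<^sub>C x - S x)" for x
    proof -
      have "norm (z *\<^sub>C x) \<le> norm (z *\<^sub>C x - S x) + norm (S x)"
        by (metis diff_add_cancel norm_triangle_ineq)
      then show ?thesis using K(2)[of x] by (simp add: norm_scaleC algebra_simps)
    qed
    have solvable: "\<exists>x. z *\<^sub>C x - S x = f" for f
    proof -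
      have "\<exists>!x. inverse z *\<^sub>C (f + S x) = x"
      proof (rule banach_fix_type[where c = "K / cmod z"])
        show "\<forall>x y. dist (inverse z *\<^sub>C (f + S x)) (inverse z *\<^sub>C (f + S y)) \<le> K / cmod z * dist x y"
        proof (intro allI)
          fix x y
          have "inverse z *\<^sub>C (f + S x) - inverse z *\<^sub>C (f + S y) = inverse z *\<^sub>C S (x - y)"
            by (simp add: linear_diff[OF lin] flip: scaleC_diff_right)
          then show "dist (inverse z *\<^sub>C (f + S x)) (inverse z *\<^sub>C (f + S y)) \<le> K / cmod z * dist x y"
            using K(2)[of "x - y"] z0
            by (simp add: dist_norm norm_scaleC norm_inverse norm_divide divide_simps mult.commute)
        qed
      qed (use z K(1) z0 in \<open>auto simp: divide_simps\<close>)
      then obtain x where "inverse z *\<^sub>C (f + S x) = x" by blast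
      then have "z *\<^sub>C x = f + S x" using z0 by (metis scaleC_scaleC right_inverse scaleC_one)
      then show ?thesis by (intro exI[of _ x]) simp
    qed
    define R where "R f = (SOME x. z *\<^sub>C x - S x = f)" for f
    have R: "z *\<^sub>C R f - S (R f) = f" for f
      unfolding R_def by (rule someI_ex[OF solvable])
    have inj: "x = y" if "z *\<^sub>C x - S x = z *\<^sub>C y - S y" for x y
    proof -
      have "z *\<^sub>C (x - y) - S (x - y) = (z *\<^sub>C x - S x) - (z *\<^sub>C y - S y)"
        unfolding scaleC_diff_right linear_diff[OF lin] by simp
      also have "\<dots> = 0" by (simp only: that diff_self)
      finally have "z *\<^sub>C (x - y) - S (x - y) = 0" .
      then have "(cmod z - K) * norm (x - y) \<le> 0" using lower[of "x - y"] by simp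
      then show ?thesis using z by (simp add: mult_le_0_iff)
    qed
    have "bounded_clinear R"
      unfolding bounded_clinear_def clinear_def
    proof (intro conjI allI exI)
      show "R (f + g) = R f + R g" for f g
      proof (rule inj)
        have "z *\<^sub>C (R f + R g) - S (R f + R g) = (z *\<^sub>C R f - S (R f)) + (z *\<^sub>C R g - S (R g))"
          by (simp add: scaleC_add_right linear_add[OF lin])
        then show "z *\<^sub>C R (f + g) - S (R (f + g)) = z *\<^sub>C (R f + R g) - S (R f + R g)"
          by (simp only: R)
      qed
      show "R (c *\<^sub>C f) = c *\<^sub>C R f" for c f
      proof (rule inj)
        have "z *\<^sub>C c *\<^sub>C R f - S (c *\<^sub>C R f) = c *\<^sub>C (z *\<^sub>C R f - S (R f))"
          by (simp only: clinear_scaleC[OF cl] scaleC_diff_right scaleC_scaleC mult.commute)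
        then show "z *\<^sub>C R (c *\<^sub>C f) - S (R (c *\<^sub>C f)) = z *\<^sub>C c *\<^sub>C R f - S (c *\<^sub>C R f)"
          by (simp only: R)
      qed
      show "norm (R f) \<le> (1 / (cmod z - K)) * norm f" for f
        using lower[of "R f"] z by (simp add: R field_simps)
    qed
    moreover have "R (z *\<^sub>C f - S f) = f" for f by (rule inj) (rule R)
    ultimately show ?thesis using R unfolding spectrum_def by blast
  qed
  then show ?thesis by (intro bdd_aboveI[of _ K]) force
qed

text \<open>The local bound at each point of the unit circle persists in a neighbourhood, so
  compactness of the circle makes it uniform.\<close>

lemma uniform_lower_bound_on_circle:
  fixes S :: "'v::complex_banach \<Rightarrow> 'v"
  assumes S: "bounded_clinear S" and radius: "spectral_radius S < 1"
  shows "\<exists>K>0. \<forall>z f. cmod z = 1 \<longrightarrow> norm f \<le> K * norm (f - z *\<^sub>C S f)"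
proof -
  have "\<exists>k>0. \<forall>f. norm f \<le> k * norm (z *\<^sub>C f - S f)" if "cmod z = 1" for z
  proof -
    have "z \<notin> spectrum S"
    proof
      assume "z \<in> spectrum S"
      then have "cmod z \<le> spectral_radius S"
        unfolding spectral_radius_def by (intro cSup_upper imageI spectrum_bounded[OF S])
      then show False using that radius by simp
    qed
    then obtain R where R: "bounded_clinear R" "\<And>f. R (z *\<^sub>C f - S f) = f"
      unfolding spectrum_def by blast
    obtain k where "0 < k" "\<And>x. norm (R x) \<le> k * norm x"
      by (rule bounded_clinear_pos_bound[OF R(1)]) blast
    then show ?thesis using R(2) by metis
  qed
  then obtain k where k: "\<And>z. cmod z = 1 \<Longrightarrow> 0 < k z"
      "\<And>z f. cmod z = 1 \<Longrightarrow> norm f \<le> k z * norm (z *\<^sub>C f - S f)" by metis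
  have near: "norm f \<le> 2 * k z * norm (w *\<^sub>C f - S f)"
    if z: "cmod z = 1" and w: "w \<in> ball z (1 / (2 * k z))" for z w f
  proof -
    have "norm (z *\<^sub>C f - S f) \<le> norm (w *\<^sub>C f - S f) + norm ((z - w) *\<^sub>C f)"
      using norm_triangle_ineq[of "w *\<^sub>C f - S f" "(z - w) *\<^sub>C f"] by (simp add: scaleC_diff_left)
    moreover have "norm ((z - w) *\<^sub>C f) \<le> 1 / (2 * k z) * norm f"
      using w unfolding norm_scaleC by (intro mult_right_mono) (auto simp: dist_norm)
    ultimately have "k z * norm (z *\<^sub>C f - S f)
        \<le> k z * (norm (w *\<^sub>C f - S f) + 1 / (2 * k z) * norm f)"
      using k(1)[OF z] by (intro mult_left_mono) auto
    then have "k z * norm (z *\<^sub>C f - S f) \<le> k z * norm (w *\<^sub>C f - S f) + norm f / 2"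
      using k(1)[OF z] by (simp add: distrib_left)
    then show ?thesis unfolding mult.assoc using k(2)[OF z, of f] by linarith
  qed
  have "compact (sphere (0::complex) 1)" by simp
  then obtain D where D: "D \<subseteq> sphere 0 1" "finite D" "sphere 0 1 \<subseteq> (\<Union>z\<in>D. ball z (1 / (2 * k z)))"
  proof (rule compactE_image)
    show "sphere (0::complex) 1 \<subseteq> (\<Union>z\<in>sphere 0 1. ball z (1 / (2 * k z)))"
      using k(1) by (force simp: dist_norm)
  qed auto
  define K where "K = 1 + (\<Sum>z\<in>D. 2 * k z)"
  have nonneg: "\<forall>z\<in>D. 0 \<le> 2 * k z" using D(1) k(1) by (force intro: less_imp_le)
  have "norm f \<le> K * norm (w *\<^sub>C f - S f)" if "cmod w = 1" for w f
  proof -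
    have "w \<in> (\<Union>z\<in>D. ball z (1 / (2 * k z)))" using that by (intro subsetD[OF D(3)]) simp
    then obtain z where z: "z \<in> D" "w \<in> ball z (1 / (2 * k z))" by blast
    have "2 * k z \<le> K"
      unfolding K_def using member_le_sum[of z D "\<lambda>z. 2 * k z"] z(1) nonneg D(2) by force
    then have "2 * k z * norm (w *\<^sub>C f - S f) \<le> K * norm (w *\<^sub>C f - S f)"
      by (intro mult_right_mono) auto
    moreover have "norm f \<le> 2 * k z * norm (w *\<^sub>C f - S f)"
      using z D(1) by (intro near) auto
    ultimately show ?thesis by linarith
  qed
  moreover have "norm (f - z *\<^sub>C S f) = norm (inverse z *\<^sub>C f - S f)" if "cmod z = 1" for z f
  proof -
    have "z \<noteq> 0" using that by auto
    then have "f - z *\<^sub>C S f = z *\<^sub>C (inverse z *\<^sub>C f - S f)"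
      by (simp add: scaleC_diff_right scaleC_scaleC)
    then show ?thesis using that by (simp add: norm_scaleC)
  qed
  moreover have "K > 0" unfolding K_def using sum_nonneg[of D "\<lambda>z. 2 * k z"] nonneg by force
  ultimately show ?thesis by (intro exI[of _ K]) (simp add: norm_inverse)
qed

lemma sum_root_of_unity_powers:
  fixes L m :: nat
  assumes "L > 0"
  shows "(\<Sum>l<L. cis (2 * pi * l / L) ^ m) = (if L dvd m then of_nat L else 0)"
proof -
  define w where "w = cis (2 * pi * m / L)"
  have eq: "cis (2 * pi * l / L) ^ m = w ^ l" for l
    unfolding w_def Complex.DeMoivre by (rule arg_cong[of _ _ cis]) simp
  have "w = exp (2 * of_real pi * \<i> * of_nat m / of_nat L)"
    by (simp add: w_def cis_conv_exp mult_ac)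
  then have w1: "w = 1 \<longleftrightarrow> L dvd m"
    using complex_root_unity_eq_1[of L m] assms by simp
  have "w ^ L = cis (real L * (2 * pi * real m / real L))"
    unfolding w_def by (rule Complex.DeMoivre)
  also have "real L * (2 * pi * real m / real L) = 2 * pi * real m" using assms by simp
  finally have wL: "w ^ L = 1" by (simp add: cis_multiple_2pi)
  show ?thesis
  proof (cases "w = 1")
    case False
    then show ?thesis using w1 wL geometric_sum[of w L] by (simp add: eq)
  qed (use w1 in \<open>simp add: eq\<close>)
qed

text \<open>For an \<open>L\<close>-th root of unity \<open>\<omega>\<close>, let \<open>V\<^sub>\<omega> = (\<Sum>i<L. \<omega>\<^sup>i S\<^sup>i)\<close>. As
  \<open>(1 - \<omega> S) V\<^sub>\<omega> = 1 - S\<^sup>L\<close>, the bound on the unit circle and the power bound give a bound of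
  \<open>V\<^sub>\<omega>\<close> that does not depend on \<open>L\<close>. Averaging \<open>\<omega> V\<^sub>\<omega>\<^sup>2\<close> over \<open>\<omega>\<close> extracts the coefficient
  of \<open>\<omega>\<^sup>L\<^sup>-\<^sup>1\<close> in \<open>V\<^sub>\<omega>\<^sup>2\<close>. It is \<open>L S\<^sup>L\<^sup>-\<^sup>1\<close>, and the factor \<open>L\<close> is the gain: a single
  factor \<open>V\<^sub>\<omega>\<close> would give boundedness only.\<close>

lemma power_decay:
  fixes S :: "'v::complex_banach \<Rightarrow> 'v"
  assumes S: "bounded_clinear S" and radius: "spectral_radius S < 1"
    and bound: "\<And>n f. norm ((S ^^ n) f) \<le> C * norm f"
  shows "\<exists>c. \<forall>n f. norm ((S ^^ n) f) \<le> c / real (Suc n) * norm f"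
proof -
  obtain K where K: "K > 0" "\<And>z f. cmod z = 1 \<Longrightarrow> norm f \<le> K * norm (f - z *\<^sub>C S f)"
    using uniform_lower_bound_on_circle[OF S radius] by blast
  have cl: "clinear S" and lin: "linear S"
    using S clinear_imp_linear by (auto simp: bounded_clinear_def)
  define V where "V L z f = (\<Sum>i<L. z ^ i *\<^sub>C (S ^^ i) f)" for L :: nat and z f
  define B where "B = K * (1 + C)"
  have V_bound: "norm (V L z f) \<le> B * norm f" if "cmod z = 1" "z ^ L = 1" for L z f
  proof -
    have "V L z f - z *\<^sub>C S (V L z f) = (\<Sum>i<L. z ^ i *\<^sub>C (S ^^ i) f - z ^ Suc i *\<^sub>C (S ^^ Suc i) f)"
      by (simp add: V_def linear_sum[OF lin] scaleC_sum_right clinear_scaleC[OF cl] scaleC_scaleC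
          sum_subtractf)
    also have "\<dots> = f - (S ^^ L) f"
      by (subst sum_lessThan_telescope') (simp add: that)
    finally have "norm (V L z f) \<le> K * norm (f - (S ^^ L) f)"
      using K(2)[OF that(1), of "V L z f"] by simp
    also have "norm (f - (S ^^ L) f) \<le> (1 + C) * norm f"
      using bound[of L f] norm_triangle_ineq4[of f "(S ^^ L) f"] by (simp add: algebra_simps)
    finally show ?thesis using K(1) by (simp add: B_def)
  qed
  have "norm ((S ^^ n) f) \<le> B\<^sup>2 / real (Suc n) * norm f" for n f
  proof -
    define L where "L = Suc n"
    define w where "w l = cis (2 * pi * real l / real L)" for l :: nat
    have w: "cmod (w l) = 1" "w l ^ L = 1" for l
    proof -
      have "w l ^ L = cis (real L * (2 * pi * real l / real L))"
        unfolding w_def by (rule Complex.DeMoivre)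
      also have "real L * (2 * pi * real l / real L) = 2 * pi * real l" by (simp add: L_def)
      finally show "w l ^ L = 1" by (simp add: cis_multiple_2pi)
    qed (simp add: w_def)
    have VV: "w l *\<^sub>C V L (w l) (V L (w l) f) = (\<Sum>i<L. \<Sum>j<L. w l ^ Suc (i + j) *\<^sub>C (S ^^ (i + j)) f)" for l
    proof -
      have "(S ^^ i) (z *\<^sub>C g) = z *\<^sub>C (S ^^ i) g" for i z g
        by (induction i) (auto simp: clinear_scaleC[OF cl])
      then show ?thesis
        by (simp add: V_def linear_sum[OF linear_funpow[OF lin]] scaleC_sum_right scaleC_scaleC
            funpow_add power_add mult_ac)
    qed
    have "(\<Sum>l<L. w l *\<^sub>C V L (w l) (V L (w l) f))
        = (\<Sum>i<L. \<Sum>j<L. \<Sum>l<L. w l ^ Suc (i + j) *\<^sub>C (S ^^ (i + j)) f)"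
      unfolding VV by (subst sum.swap) (intro sum.cong refl sum.swap)
    also have "\<dots> = (\<Sum>i<L. \<Sum>j<L. (\<Sum>l<L. w l ^ Suc (i + j)) *\<^sub>C (S ^^ (i + j)) f)"
      by (simp only: scaleC_sum_left)
    also have "\<dots> = (\<Sum>i<L. \<Sum>j<L. if j = n - i then of_nat L *\<^sub>C (S ^^ n) f else 0)"
    proof (intro sum.cong refl)
      fix i j assume ij: "i \<in> {..<L}" "j \<in> {..<L}"
      have "(\<Sum>l<L. w l ^ Suc (i + j)) = (if L dvd Suc (i + j) then of_nat L else 0)"
        unfolding w_def by (rule sum_root_of_unity_powers) (simp add: L_def)
      moreover have "L dvd Suc (i + j) \<longleftrightarrow> j = n - i"
      proof
        assume "L dvd Suc (i + j)"
        then obtain r where r: "Suc (i + j) = L * r" by (elim dvdE)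
        have "0 < L * r" "L * r < L * 2" unfolding r[symmetric] using ij by auto
        then have "r = 1" by (cases r) auto
        then show "j = n - i" using r by (simp add: L_def)
      qed (use ij in \<open>auto simp: L_def\<close>)
      moreover have "i + (n - i) = n" using ij by (auto simp: L_def)
      ultimately show "(\<Sum>l<L. w l ^ Suc (i + j)) *\<^sub>C (S ^^ (i + j)) f
          = (if j = n - i then of_nat L *\<^sub>C (S ^^ n) f else 0)" by auto
    qed
    also have "\<dots> = (\<Sum>i<L. of_nat L *\<^sub>C (S ^^ n) f)"
      by (intro sum.cong refl) (simp add: L_def)
    also have "\<dots> = of_nat L *\<^sub>C of_nat L *\<^sub>C (S ^^ n) f"
      using scaleC_of_real[of "real L" "of_nat L *\<^sub>C (S ^^ n) f"] by (simp add: sum_constant_scaleR)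
    finally have "real L * (real L * norm ((S ^^ n) f))
        = norm (\<Sum>l<L. w l *\<^sub>C V L (w l) (V L (w l) f))"
      by (simp add: norm_scaleC)
    also have "\<dots> \<le> (\<Sum>l<L. B * (B * norm f))"
    proof (rule sum_norm_le)
      fix l
      have "norm (V L (w l) (V L (w l) f)) \<le> B * norm (V L (w l) f)" by (rule V_bound[OF w])
      also have "\<dots> \<le> B * (B * norm f)"
      proof (cases "f = 0")
        case True
        then show ?thesis using V_bound[OF w, of l "0::'v"] by simp
      next
        case False
        then have "1 \<le> C" using bound[of 0 f] by simp
        then show ?thesis using K(1) by (intro mult_left_mono V_bound[OF w]) (simp add: B_def)
      qed
      finally show "norm (w l *\<^sub>C V L (w l) (V L (w l) f)) \<le> B * (B * norm f)"
        by (simp add: norm_scaleC w)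
    qed
    finally have "real L * (real L * norm ((S ^^ n) f)) \<le> real L * (B\<^sup>2 * norm f)"
      by (simp add: power2_eq_square mult_ac)
    then have "real L * norm ((S ^^ n) f) \<le> B\<^sup>2 * norm f"
      by (rule mult_left_le_imp_le) (simp add: L_def)
    then show ?thesis by (simp add: L_def field_simps)
  qed
  then show ?thesis by blast
qed


section \<open>Rare event operators with explicit constants\<close>

text \<open>The constants of the assumptions are fixed here, so that later bounds can name them.\<close>

locale REPFO_constants = REPFO T \<nu>\<^sub>0 \<Phi> pair one P\<^sub>0 \<phi>\<^sub>0 Q\<^sub>0 \<mu>\<^sub>0 mult_ind E A
  for T :: "'m::metric_space \<Rightarrow> 'm" and \<nu>\<^sub>0 \<Phi>
    and pair :: "'v::complex_banach \<Rightarrow> ('m \<Rightarrow> complex) \<Rightarrow> complex" and one P\<^sub>0 \<phi>\<^sub>0 Q\<^sub>0 \<mu>\<^sub>0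
    and mult_ind :: "'m set \<Rightarrow> 'v \<Rightarrow> 'v" and E :: "real set" and A :: "real \<Rightarrow> 'm set" +
  fixes \<alpha> D K\<^sub>0 N :: real and wnorm :: "'v \<Rightarrow> real" and \<pi> :: "real \<Rightarrow> real"
  assumes alpha: "0 < \<alpha>" "\<alpha> < 1"
    and D_pos: "0 < D" and K0_nonneg: "0 \<le> K\<^sub>0" and N_pos: "0 < N"
    and wnorm_seminorm: "cseminorm wnorm"
    and wnorm_le: "\<And>f. wnorm f \<le> norm f"
    and weak_power: "\<And>\<epsilon> n f. \<epsilon> \<in> E \<Longrightarrow> wnorm ((rare_op P\<^sub>0 mult_ind A \<epsilon> ^^ n) f) \<le> D * wnorm f"
    and strong_power: "\<And>\<epsilon> n f. \<epsilon> \<in> E \<Longrightarrow>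
      norm ((rare_op P\<^sub>0 mult_ind A \<epsilon> ^^ n) f) \<le> D * \<alpha> ^ n * norm f + D * wnorm f"
    and pi_nonneg: "\<And>\<epsilon>. \<epsilon> \<in> E \<Longrightarrow> 0 \<le> \<pi> \<epsilon>"
    and pi_tendsto: "(\<pi> \<longlongrightarrow> 0) (at 0 within E)"
    and perturbation: "\<And>\<epsilon> f. \<epsilon> \<in> E \<Longrightarrow>
      wnorm (rare_op P\<^sub>0 mult_ind A \<epsilon> f - P\<^sub>0 f) \<le> \<pi> \<epsilon> * norm f"
    and rare: "\<And>\<epsilon> f. \<epsilon> \<in> E \<Longrightarrow>
      cmod (functional_of pair (mult_ind (A \<epsilon>) f)) * norm (mult_ind (A \<epsilon>) \<phi>\<^sub>0)
        \<le> K\<^sub>0 * norm f * cmod (functional_of pair (mult_ind (A \<epsilon>) \<phi>\<^sub>0))"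
    and functional_bound: "\<And>f. cmod (functional_of pair f) \<le> N * norm f"
begin

abbreviation \<nu> :: "'v \<Rightarrow> complex" where "\<nu> \<equiv> functional_of pair"

abbreviation L :: "real \<Rightarrow> 'v \<Rightarrow> 'v" where "L \<equiv> rare_op P\<^sub>0 mult_ind A"

definition centered :: "'v \<Rightarrow> 'v" where "centered f = f - \<nu> f *\<^sub>C \<phi>\<^sub>0"

lemma nu_clinear: "clinear \<nu>" and P0_clinear: "clinear P\<^sub>0" and Q0_clinear: "clinear Q\<^sub>0"
  using nu0_bounded P0_bounded Q0_bounded by (auto simp: bounded_clinear_def)

lemmas nu_linear = clinear_imp_linear[OF nu_clinear]
lemmas P0_linear = clinear_imp_linear[OF P0_clinear]
lemmas Q0_linear = clinear_imp_linear[OF Q0_clinear]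
lemmas mult_linear = clinear_imp_linear[OF mult_clinear]

lemma nu_scaleC: "\<nu> (c *\<^sub>C f) = c * \<nu> f"
  using clinear_scaleC[OF nu_clinear] by (simp add: scaleC_complex_def)

lemma space_nu0: "space \<nu>\<^sub>0 = UNIV" and space_mu0: "space \<mu>\<^sub>0 = UNIV"
  using sets_eq_imp_space_eq[OF sets_nu0] sets_eq_imp_space_eq[OF sets_mu0] by auto

lemma indicator_Phi_imp_borel:
  assumes "indicator B \<in> \<Phi>" shows "B \<in> sets borel"
proof -
  have "(indicator B :: 'm \<Rightarrow> complex) \<in> borel_measurable borel" by (rule Phi_measurable[OF assms])
  then show ?thesis by (simp add: borel_measurable_indicator_iff)
qed

lemma pair_phi0_indicator:
  assumes "indicator B \<in> \<Phi>"
  shows "pair \<phi>\<^sub>0 (indicator B) = complex_of_real (measure \<mu>\<^sub>0 B)"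
  by (rule mu0_density[OF indicator_Phi_imp_borel[OF assms] assms])

lemma pair_one_indicator:
  assumes "indicator B \<in> \<Phi>"
  shows "pair one (indicator B) = complex_of_real (measure \<nu>\<^sub>0 B)"
proof -
  have "pair one (indicator B) = (LINT x|\<nu>\<^sub>0. complex_of_real (indicator B x))"
    unfolding pair_one[OF assms] by (intro Bochner_Integration.integral_cong) (auto simp: indicator_def)
  also have "\<dots> = complex_of_real (LINT x|\<nu>\<^sub>0. indicator B x)" by (rule integral_complex_of_real)
  finally show ?thesis
    using indicator_Phi_imp_borel[OF assms] by (simp add: sets_nu0 space_nu0)
qed

lemma nu_phi0: "\<nu> \<phi>\<^sub>0 = 1"
proof -
  have "indicator (UNIV :: 'm set) = (\<lambda>_. 1 :: complex)" by auto
  then have "\<nu> \<phi>\<^sub>0 = complex_of_real (measure \<mu>\<^sub>0 UNIV)"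
    using pair_phi0_indicator[of UNIV] Phi_one by (simp add: functional_of_def)
  then show ?thesis using prob_space.prob_space[OF prob_mu0] by (simp add: space_mu0)
qed

lemma nu_one: "\<nu> one = 1"
proof -
  have "indicator (UNIV :: 'm set) = (\<lambda>_. 1 :: complex)" by auto
  then have "\<nu> one = complex_of_real (measure \<nu>\<^sub>0 UNIV)"
    using pair_one_indicator[of UNIV] Phi_one by (simp add: functional_of_def)
  then show ?thesis using prob_space.prob_space[OF prob_nu0] by (simp add: space_nu0)
qed

lemma phi0_nonzero: "\<phi>\<^sub>0 \<noteq> 0"
  using nu_phi0 linear_0[OF nu_linear] by auto

lemma centered_phi0: "centered \<phi>\<^sub>0 = 0"
  by (simp add: centered_def nu_phi0)

lemma nu_centered: "\<nu> (centered f) = 0"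
  by (simp add: centered_def linear_diff[OF nu_linear] nu_scaleC nu_phi0)

lemma centered_decomp: "f = \<nu> f *\<^sub>C \<phi>\<^sub>0 + centered f"
  by (simp add: centered_def)

lemma centered_linear: "linear centered"
proof (rule linearI)
  show "centered (f + g) = centered f + centered g" for f g
    by (simp add: centered_def linear_add[OF nu_linear] scaleC_add_left)
  show "centered (r *\<^sub>R f) = r *\<^sub>R centered f" for r f
    by (simp add: centered_def nu_scaleC scaleC_diff_right scaleC_scaleC flip: scaleC_of_real)
qed

lemma centered_scaleC: "centered (c *\<^sub>C f) = c *\<^sub>C centered f"
  by (simp add: centered_def nu_scaleC scaleC_diff_right scaleC_scaleC)

definition centering_norm :: real where "centering_norm = 1 + N * norm \<phi>\<^sub>0"

lemma centering_norm_pos: "0 < centering_norm"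
  using N_pos by (simp add: centering_norm_def add_pos_nonneg)

lemma norm_centered: "norm (centered f) \<le> centering_norm * norm f"
proof -
  have "norm (centered f) \<le> norm f + cmod (\<nu> f) * norm \<phi>\<^sub>0"
    unfolding centered_def by (rule order_trans[OF norm_triangle_ineq4]) (simp add: norm_scaleC)
  also have "\<dots> \<le> norm f + (N * norm f) * norm \<phi>\<^sub>0"
    by (intro add_left_mono mult_right_mono functional_bound) simp
  finally show ?thesis by (simp add: centering_norm_def algebra_simps)
qed

lemma L_zero: "L 0 = P\<^sub>0"
  by (simp add: rare_op_def)

lemma L_nonzero: "\<epsilon> \<noteq> 0 \<Longrightarrow> L \<epsilon> f = P\<^sub>0 (f - mult_ind (A \<epsilon>) f)"
  by (simp add: rare_op_def)

lemma L_clinear: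
  assumes "\<epsilon> \<in> E" shows "clinear (L \<epsilon>)"
proof (cases "\<epsilon> = 0")
  case False
  then show ?thesis
    unfolding clinear_def L_nonzero[OF False]
    by (simp add: linear_add[OF mult_linear[OF assms]] clinear_scaleC[OF mult_clinear[OF assms]]
        clinear_scaleC[OF P0_clinear] linear_add[OF P0_linear] linear_diff[OF P0_linear]
        scaleC_diff_right)
qed (simp add: L_zero P0_clinear)

lemmas L_linear = clinear_imp_linear[OF L_clinear]
lemmas L_power_linear = linear_funpow[OF L_linear]

lemma L_power_scaleC: "\<epsilon> \<in> E \<Longrightarrow> (L \<epsilon> ^^ n) (c *\<^sub>C f) = c *\<^sub>C (L \<epsilon> ^^ n) f"
  by (induction n) (auto simp: clinear_scaleC[OF L_clinear])

lemma L_power_bound: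
  assumes "\<epsilon> \<in> E" shows "norm ((L \<epsilon> ^^ n) f) \<le> 2 * D * norm f"
proof -
  have "D * \<alpha> ^ n * norm f \<le> D * 1 * norm f"
    using alpha D_pos by (intro mult_right_mono mult_left_mono power_le_one) auto
  moreover have "D * wnorm f \<le> D * norm f" using D_pos wnorm_le by simp
  ultimately show ?thesis using strong_power[OF assms, of n f] by simp
qed

lemma P0_power_bound: "norm ((P\<^sub>0 ^^ n) f) \<le> 2 * D * norm f"
  using L_power_bound[OF zero_in_E] by (simp add: L_zero)

lemma P0_bound: "norm (P\<^sub>0 f) \<le> 2 * D * norm f"
  using P0_power_bound[of 1] by simp

lemma Q0_power_eq_P0_power:
  assumes "\<nu> f = 0" shows "(Q\<^sub>0 ^^ n) f = (P\<^sub>0 ^^ n) f"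
proof -
  have "(Q\<^sub>0 ^^ n) f = (P\<^sub>0 ^^ n) f \<and> \<nu> ((P\<^sub>0 ^^ n) f) = 0"
  proof (induction n)
    case (Suc n)
    then show ?case using P0_decomp[of "(P\<^sub>0 ^^ n) f"] nu0_P0[of "(P\<^sub>0 ^^ n) f"] by simp
  qed (simp add: assms)
  then show ?thesis ..
qed

text \<open>On the kernel of \<open>\<nu>\<close> the powers of \<open>P\<^sub>0\<close> and \<open>Q\<^sub>0\<close> agree. Hence \<open>Q\<^sub>0\<close> is power bounded, and
  the bound on its spectral radius turns this into decay.\<close>

lemma P0_decay_on_kernel:
  obtains c where "0 \<le> c" "\<And>n f. \<nu> f = 0 \<Longrightarrow> norm ((P\<^sub>0 ^^ n) f) \<le> c / real (Suc n) * norm f"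
proof -
  have "norm ((Q\<^sub>0 ^^ n) f) \<le> (1 + 2 * D * centering_norm) * norm f" for n f
  proof (cases n)
    case 0
    then show ?thesis using D_pos centering_norm_pos
        mult_right_mono[of 1 "1 + 2 * D * centering_norm" "norm f"] by simp
  next
    case (Suc k)
    have "Q\<^sub>0 f = Q\<^sub>0 (centered f)"
      by (simp add: centered_def linear_diff[OF Q0_linear] clinear_scaleC[OF Q0_clinear] Q0_phi0
          linear_0[OF linear_scaleC_right])
    then have "(Q\<^sub>0 ^^ n) f = (P\<^sub>0 ^^ n) (centered f)"
      unfolding Q0_power_eq_P0_power[OF nu_centered, symmetric]
      by (simp add: Suc funpow_Suc_right del: funpow.simps)
    then have "norm ((Q\<^sub>0 ^^ n) f) \<le> 2 * D * norm (centered f)" by (simp add: P0_power_bound)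
    also have "\<dots> \<le> 2 * D * (centering_norm * norm f)"
      using D_pos norm_centered by simp
    finally have "norm ((Q\<^sub>0 ^^ n) f) \<le> 2 * D * (centering_norm * norm f)" .
    then show ?thesis using norm_ge_zero[of f] unfolding distrib_right mult.assoc by linarith
  qed
  then obtain c where c: "\<And>n f. norm ((Q\<^sub>0 ^^ n) f) \<le> c / real (Suc n) * norm f"
    using power_decay[OF Q0_bounded Q0_radius] by blast
  have "0 \<le> c * norm \<phi>\<^sub>0" using order_trans[OF norm_ge_zero c[of 0 \<phi>\<^sub>0]] by simp
  then have "0 \<le> c" using phi0_nonzero by (simp add: zero_le_mult_iff)
  then show ?thesis
    using c Q0_power_eq_P0_power by (intro that[of c]) metis+
qed

lemma wnorm_triangle: "wnorm (f + g) \<le> wnorm f + wnorm g"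
  and wnorm_scaleC: "wnorm (c *\<^sub>C f) = cmod c * wnorm f"
  using wnorm_seminorm by (auto simp: cseminorm_def)

lemma eventually_parameter: "\<forall>\<^sub>F \<epsilon> in at 0 within E. \<epsilon> \<in> E \<and> \<epsilon> \<noteq> 0"
  by (simp add: eventually_at_filter)

lemma power_perturbation:
  "\<exists>c. \<forall>\<epsilon>\<in>E. \<forall>f. wnorm ((L \<epsilon> ^^ n) f - (P\<^sub>0 ^^ n) f) \<le> c * \<pi> \<epsilon> * norm f"
proof (induction n)
  case 0
  show ?case using wnorm_scaleC[of 0] by (intro exI[of _ 0]) simp
next
  case (Suc n)
  then obtain c where c: "\<And>\<epsilon> f. \<epsilon> \<in> E \<Longrightarrow> wnorm ((L \<epsilon> ^^ n) f - (P\<^sub>0 ^^ n) f) \<le> c * \<pi> \<epsilon> * norm f"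
    by blast
  have "wnorm ((L \<epsilon> ^^ Suc n) f - (P\<^sub>0 ^^ Suc n) f) \<le> (D * c + 2 * D) * \<pi> \<epsilon> * norm f"
    if e: "\<epsilon> \<in> E" for \<epsilon> f
  proof -
    let ?g = "(P\<^sub>0 ^^ n) f"
    have "(L \<epsilon> ^^ Suc n) f - (P\<^sub>0 ^^ Suc n) f
        = L \<epsilon> ((L \<epsilon> ^^ n) f - ?g) + (L \<epsilon> ?g - P\<^sub>0 ?g)"
      by (simp add: linear_diff[OF L_linear[OF e]])
    then have "wnorm ((L \<epsilon> ^^ Suc n) f - (P\<^sub>0 ^^ Suc n) f)
        \<le> wnorm (L \<epsilon> ((L \<epsilon> ^^ n) f - ?g)) + wnorm (L \<epsilon> ?g - P\<^sub>0 ?g)"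
      by (simp only: wnorm_triangle)
    also have "\<dots> \<le> D * (c * \<pi> \<epsilon> * norm f) + \<pi> \<epsilon> * (2 * D * norm f)"
    proof (rule add_mono)
      have "wnorm (L \<epsilon> ((L \<epsilon> ^^ n) f - ?g)) \<le> D * wnorm ((L \<epsilon> ^^ n) f - ?g)"
        using weak_power[OF e, of 1] by simp
      also have "\<dots> \<le> D * (c * \<pi> \<epsilon> * norm f)" using c[OF e] D_pos by (intro mult_left_mono) auto
      finally show "wnorm (L \<epsilon> ((L \<epsilon> ^^ n) f - ?g)) \<le> D * (c * \<pi> \<epsilon> * norm f)" .
      have "wnorm (L \<epsilon> ?g - P\<^sub>0 ?g) \<le> \<pi> \<epsilon> * norm ?g" by (rule perturbation[OF e])
      also have "\<dots> \<le> \<pi> \<epsilon> * (2 * D * norm f)"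
        by (intro mult_left_mono P0_power_bound pi_nonneg e)
      finally show "wnorm (L \<epsilon> ?g - P\<^sub>0 ?g) \<le> \<pi> \<epsilon> * (2 * D * norm f)" .
    qed
    finally show ?thesis by (simp add: algebra_simps)
  qed
  then show ?case by blast
qed

text \<open>This uniform contraction plays the role of a spectral gap of \<open>P\<^sub>\<epsilon>\<close>. On the kernel of
  \<open>\<nu>\<close>, \<open>P\<^sub>0\<^sup>n f\<close> is small in norm and \<open>P\<^sub>\<epsilon>\<^sup>n f - P\<^sub>0\<^sup>n f\<close> is small in the weak seminorm, whence \<open>P\<^sub>\<epsilon>\<^sup>n f\<close> is weakly small.
  Another \<open>n\<close> steps and the two-norm inequality make it small in norm.\<close>

lemma contraction_on_kernel:
  assumes "0 < \<sigma>"
  shows "\<exists>m\<^sub>0. \<forall>m\<ge>m\<^sub>0. \<forall>\<^sub>F \<epsilon> in at 0 within E. \<forall>f. \<nu> f = 0 \<longrightarrow> norm ((L \<epsilon> ^^ m) f) \<le> \<sigma> * norm f"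
proof -
  obtain c where c: "0 \<le> c" "\<And>n f. \<nu> f = 0 \<Longrightarrow> norm ((P\<^sub>0 ^^ n) f) \<le> c / real (Suc n) * norm f"
    by (rule P0_decay_on_kernel) blast
  have "(\<lambda>n. 2 * D * (D * \<alpha> ^ n * (2 * D) + D * (c * inverse (real (Suc n)))))
      \<longlonglongrightarrow> 2 * D * (D * 0 * (2 * D) + D * (c * 0))"
    using alpha by (intro tendsto_intros LIMSEQ_realpow_zero LIMSEQ_inverse_real_of_nat) auto
  then have "\<forall>\<^sub>F n in sequentially. 2 * D * (D * \<alpha> ^ n * (2 * D) + D * (c * inverse (real (Suc n)))) < \<sigma> / 2"
    using assms by (intro order_tendstoD(2)) auto
  then obtain n where n: "2 * D * (D * \<alpha> ^ n * (2 * D) + D * (c * inverse (real (Suc n)))) < \<sigma> / 2"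
    by (auto simp: eventually_sequentially)
  obtain c' where c': "\<And>\<epsilon> f. \<epsilon> \<in> E \<Longrightarrow> wnorm ((L \<epsilon> ^^ n) f - (P\<^sub>0 ^^ n) f) \<le> c' * \<pi> \<epsilon> * norm f"
    using power_perturbation by blast
  have "((\<lambda>\<epsilon>. 2 * D * (D * (c' * \<pi> \<epsilon>))) \<longlongrightarrow> 2 * D * (D * (c' * 0))) (at 0 within E)"
    by (intro tendsto_intros pi_tendsto)
  then have "\<forall>\<^sub>F \<epsilon> in at 0 within E. 2 * D * (D * (c' * \<pi> \<epsilon>)) < \<sigma> / 2"
    using assms by (intro order_tendstoD(2)) auto
  then have "\<forall>\<^sub>F \<epsilon> in at 0 within E. \<forall>f. \<nu> f = 0 \<longrightarrow> norm ((L \<epsilon> ^^ m) f) \<le> \<sigma> * norm f"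
    if m: "n + n \<le> m" for m
    using eventually_parameter
  proof eventually_elim
    case (elim \<epsilon>)
    then have e: "\<epsilon> \<in> E" by simp
    show ?case
    proof (intro allI impI)
      fix f assume f: "\<nu> f = 0"
      let ?g = "(L \<epsilon> ^^ n) f"
      have "wnorm ?g \<le> wnorm ((L \<epsilon> ^^ n) f - (P\<^sub>0 ^^ n) f) + wnorm ((P\<^sub>0 ^^ n) f)"
        using wnorm_triangle[of "?g - (P\<^sub>0 ^^ n) f" "(P\<^sub>0 ^^ n) f"] by simp
      also have "\<dots> \<le> c' * \<pi> \<epsilon> * norm f + c / real (Suc n) * norm f"
        by (intro add_mono c' e order_trans[OF wnorm_le c(2)] f)
      finally have w: "wnorm ?g \<le> c' * \<pi> \<epsilon> * norm f + c / real (Suc n) * norm f" .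
      have "(L \<epsilon> ^^ m) f = (L \<epsilon> ^^ (m - (n + n))) ((L \<epsilon> ^^ n) ?g)"
        using m by (simp flip: funpow_add[THEN fun_cong, unfolded comp_def])
      then have "norm ((L \<epsilon> ^^ m) f) \<le> 2 * D * norm ((L \<epsilon> ^^ n) ?g)"
        by (simp add: L_power_bound[OF e])
      also have "\<dots> \<le> 2 * D * (D * \<alpha> ^ n * norm ?g + D * wnorm ?g)"
        using D_pos strong_power[OF e] by simp
      also have "\<dots> \<le> 2 * D * (D * \<alpha> ^ n * (2 * D * norm f)
          + D * (c' * \<pi> \<epsilon> * norm f + c / real (Suc n) * norm f))"
        using D_pos alpha by (intro mult_left_mono add_mono L_power_bound[OF e] w) auto
      also have "\<dots> = (2 * D * (D * \<alpha> ^ n * (2 * D) + D * (c * inverse (real (Suc n))))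
          + 2 * D * (D * (c' * \<pi> \<epsilon>))) * norm f"
        by (simp add: algebra_simps divide_inverse)
      also have "\<dots> \<le> \<sigma> * norm f"
        using n elim by (intro mult_right_mono norm_ge_zero) linarith
      finally show "norm ((L \<epsilon> ^^ m) f) \<le> \<sigma> * norm f" .
    qed
  qed
  then show ?thesis by blast
qed

end


section \<open>Survival and entrance probabilities\<close>

text \<open>Multiplication with \<open>x\<close> does not amplify the errors of earlier steps, so they just add up.\<close>

lemma distance_to_geometric:
  fixes a :: "nat \<Rightarrow> real"
  assumes "a 0 = 1" "0 \<le> x" "x \<le> 1"
  shows "\<bar>a n - x ^ n\<bar> \<le> (\<Sum>j<n. \<bar>a (Suc j) - x * a j\<bar>)"
proof (induction n)
  case (Suc n)
  have "a (Suc n) - x ^ Suc n = (a (Suc n) - x * a n) + x * (a n - x ^ n)"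
    by (simp add: algebra_simps)
  then have "\<bar>a (Suc n) - x ^ Suc n\<bar> \<le> \<bar>a (Suc n) - x * a n\<bar> + x * \<bar>a n - x ^ n\<bar>"
    using assms(2) abs_triangle_ineq[of "a (Suc n) - x * a n" "x * (a n - x ^ n)"] by (simp add: abs_mult)
  moreover have "x * \<bar>a n - x ^ n\<bar> \<le> \<bar>a n - x ^ n\<bar>" using assms by (simp add: mult_left_le_one_le)
  ultimately show ?case using Suc by simp
qed (simp add: assms)

definition avoiding :: "('m \<Rightarrow> 'm) \<Rightarrow> 'm set \<Rightarrow> nat \<Rightarrow> 'm set"
  where "avoiding T B n = {x. \<forall>j<n. (T ^^ j) x \<notin> B}"

definition first_entrance :: "('m \<Rightarrow> 'm) \<Rightarrow> 'm set \<Rightarrow> nat \<Rightarrow> 'm set"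
  where "first_entrance T B n = {x \<in> avoiding T B n. (T ^^ n) x \<in> B}"

context REPFO_constants
begin

lemma indicator_A_Phi: "\<epsilon> \<in> E \<Longrightarrow> indicator (A \<epsilon>) \<in> \<Phi>"
  using Phi_mult[OF _ Phi_one] by simp

text \<open>Both \<open>P\<^sub>0\<close> and the multiplication with an indicator have a dual operation on \<open>\<Phi>\<close>. The powers of
  \<open>P\<^sub>\<epsilon>\<close> thus count the mass that has not yet visited \<open>A\<^sub>\<epsilon>\<close>.\<close>

lemma pair_L_power:
  assumes e: "\<epsilon> \<in> E" "\<epsilon> \<noteq> 0" and g: "g \<in> \<Phi>"
  shows "(\<lambda>x. indicator (avoiding T (A \<epsilon>) n) x * g ((T ^^ n) x)) \<in> \<Phi>
    \<and> pair ((L \<epsilon> ^^ n) f) g = pair f (\<lambda>x. indicator (avoiding T (A \<epsilon>) n) x * g ((T ^^ n) x))"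
  using g
proof (induction n arbitrary: g)
  case 0
  then show ?case by (simp add: avoiding_def)
next
  case (Suc n)
  have gT: "(\<lambda>x. g (T x)) \<in> \<Phi>" using Phi_comp[OF Suc.prems] by (simp add: comp_def)
  let ?k = "\<lambda>x. g (T x) + (-1) * (indicator (A \<epsilon>) x * g (T x))"
  note cut = Phi_mult[OF e(1) gT]
  have k: "?k \<in> \<Phi>" by (intro Phi_add Phi_scale gT cut)
  have step: "pair (L \<epsilon> h) g = pair h ?k" for h
  proof -
    have "pair (L \<epsilon> h) g = pair (h - mult_ind (A \<epsilon>) h) (\<lambda>x. g (T x))"
      using P0_transfer[OF Suc.prems] by (simp add: L_nonzero[OF e(2)] comp_def)
    also have "\<dots> = pair h (\<lambda>x. g (T x)) - pair (mult_ind (A \<epsilon>) h) (\<lambda>x. g (T x))"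
      by (rule linear_diff[OF clinear_imp_linear[OF pair_clinear[OF gT]]])
    also have "\<dots> = pair h ?k"
      by (simp only: pair_add[OF gT Phi_scale[OF cut]] pair_scale[OF cut] pair_mult[OF e(1) gT]) simp
    finally show ?thesis .
  qed
  have eq: "(\<lambda>x. indicator (avoiding T (A \<epsilon>) n) x * ?k ((T ^^ n) x))
      = (\<lambda>x. indicator (avoiding T (A \<epsilon>) (Suc n)) x * g ((T ^^ Suc n) x))"
    by (rule ext) (auto simp: indicator_def avoiding_def less_Suc_eq)
  show ?case using Suc.IH[OF k] step[of "(L \<epsilon> ^^ n) f"] unfolding eq by simp
qed

lemma pair_L_power_indicator:
  assumes e: "\<epsilon> \<in> E" "\<epsilon> \<noteq> 0"
  shows "indicator (avoiding T (A \<epsilon>) n) \<in> \<Phi>" "\<nu> ((L \<epsilon> ^^ n) f) = pair f (indicator (avoiding T (A \<epsilon>) n))"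
    and "indicator (first_entrance T (A \<epsilon>) n) \<in> \<Phi>"
      "\<nu> (mult_ind (A \<epsilon>) ((L \<epsilon> ^^ n) f)) = pair f (indicator (first_entrance T (A \<epsilon>) n))"
proof -
  have hit: "(\<lambda>x. indicator (avoiding T (A \<epsilon>) n) x * indicator (A \<epsilon>) ((T ^^ n) x))
      = (indicator (first_entrance T (A \<epsilon>) n) :: 'm \<Rightarrow> complex)"
    by (rule ext) (auto simp: indicator_def first_entrance_def)
  show "indicator (avoiding T (A \<epsilon>) n) \<in> \<Phi>" "\<nu> ((L \<epsilon> ^^ n) f) = pair f (indicator (avoiding T (A \<epsilon>) n))"
    using pair_L_power[OF e Phi_one, of n f] by (simp_all add: functional_of_def)
  show "indicator (first_entrance T (A \<epsilon>) n) \<in> \<Phi>"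
      "\<nu> (mult_ind (A \<epsilon>) ((L \<epsilon> ^^ n) f)) = pair f (indicator (first_entrance T (A \<epsilon>) n))"
    using pair_L_power[OF e indicator_A_Phi[OF e(1)], of n f] pair_mult[OF e(1) Phi_one]
    unfolding hit by (simp_all add: functional_of_def)
qed

abbreviation \<Delta> :: "real \<Rightarrow> real" where "\<Delta> \<epsilon> \<equiv> measure \<mu>\<^sub>0 (A \<epsilon>)"

abbreviation survival :: "real \<Rightarrow> nat \<Rightarrow> real"
  where "survival \<epsilon> n \<equiv> measure \<mu>\<^sub>0 (avoiding T (A \<epsilon>) n)"

abbreviation hitting :: "real \<Rightarrow> nat \<Rightarrow> real"
  where "hitting \<epsilon> n \<equiv> measure \<mu>\<^sub>0 (first_entrance T (A \<epsilon>) n)"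

lemma nu_mult_phi0: "\<epsilon> \<in> E \<Longrightarrow> \<nu> (mult_ind (A \<epsilon>) \<phi>\<^sub>0) = complex_of_real (\<Delta> \<epsilon>)"
  using pair_mult[OF _ Phi_one, of \<epsilon> \<phi>\<^sub>0] pair_phi0_indicator[OF indicator_A_Phi]
  by (simp add: functional_of_def)

lemma nu_L_power_phi0:
  assumes "\<epsilon> \<in> E" "\<epsilon> \<noteq> 0"
  shows "\<nu> ((L \<epsilon> ^^ n) \<phi>\<^sub>0) = complex_of_real (survival \<epsilon> n)"
    and "\<nu> (mult_ind (A \<epsilon>) ((L \<epsilon> ^^ n) \<phi>\<^sub>0)) = complex_of_real (hitting \<epsilon> n)"
  using pair_L_power_indicator[OF assms] pair_phi0_indicator by auto

lemma survival_le_1: "survival \<epsilon> n \<le> 1"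
  by (rule prob_space.prob_le_1[OF prob_mu0])

lemma survival_0: "survival \<epsilon> 0 = 1"
  using prob_space.prob_space[OF prob_mu0] by (simp add: avoiding_def space_mu0)

lemma survival_Suc:
  assumes "\<epsilon> \<in> E" "\<epsilon> \<noteq> 0"
  shows "survival \<epsilon> (Suc n) = survival \<epsilon> n - hitting \<epsilon> n"
proof -
  have "complex_of_real (survival \<epsilon> (Suc n)) = complex_of_real (survival \<epsilon> n - hitting \<epsilon> n)"
    unfolding nu_L_power_phi0[OF assms, symmetric] of_real_diff
    by (simp add: L_nonzero[OF assms(2)] nu0_P0 linear_diff[OF nu_linear])
  then show ?thesis by (simp only: of_real_eq_iff)
qed

text \<open>Let \<open>h = P\<^sub>0(1\<^sub>A \<phi>\<^sub>0)\<close>. As \<open>P\<^sub>\<epsilon> \<phi>\<^sub>0 = \<phi>\<^sub>0 - h\<close>, the iterates telescope, and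
  \<open>\<nu>(1\<^sub>A P\<^sub>\<epsilon>\<^sup>k h)\<close> is the \<open>\<mu>\<^sub>0\<close>-measure of the points of \<open>A\<close> with first return at time \<open>k + 1\<close>.\<close>

lemma L_power_phi0_Suc:
  assumes "\<epsilon> \<in> E" "\<epsilon> \<noteq> 0"
  shows "(L \<epsilon> ^^ Suc n) \<phi>\<^sub>0 = (L \<epsilon> ^^ n) \<phi>\<^sub>0 - (L \<epsilon> ^^ n) (P\<^sub>0 (mult_ind (A \<epsilon>) \<phi>\<^sub>0))"
proof -
  have "L \<epsilon> \<phi>\<^sub>0 = \<phi>\<^sub>0 - P\<^sub>0 (mult_ind (A \<epsilon>) \<phi>\<^sub>0)"
    by (simp add: L_nonzero[OF assms(2)] linear_diff[OF P0_linear] P0_phi0)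
  then show ?thesis
    by (simp add: funpow_Suc_right linear_diff[OF L_power_linear[OF assms(1)]] del: funpow.simps)
qed

text \<open>The factor of \<open>\<Delta> \<epsilon>\<close> is the quantity that tends to the extremal index as first
  \<open>\<epsilon> \<rightarrow> 0\<close> and then \<open>k \<rightarrow> \<infinity>\<close>.\<close>

lemma hitting_eq_return_ratios:
  assumes e: "\<epsilon> \<in> E" "\<epsilon> \<noteq> 0" and pos: "0 < \<Delta> \<epsilon>"
  shows "hitting \<epsilon> k = \<Delta> \<epsilon> * (1 - (\<Sum>j<k. return_ratio T \<mu>\<^sub>0 (A \<epsilon>) j))"
proof (induction k)
  case 0
  have "first_entrance T (A \<epsilon>) 0 = A \<epsilon>" by (auto simp: first_entrance_def avoiding_def)
  then show ?case by simp
next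
  case (Suc k)
  let ?m = "mult_ind (A \<epsilon>)"
  let ?return = "{x \<in> A \<epsilon>. (\<forall>j\<in>{1..k}. (T ^^ j) x \<notin> A \<epsilon>) \<and> (T ^^ (k + 1)) x \<in> A \<epsilon>}"
  note hit_Phi = pair_L_power_indicator(3)[OF e, of k]
  have gT: "(indicator (first_entrance T (A \<epsilon>) k) \<circ> T :: 'm \<Rightarrow> complex) \<in> \<Phi>" by (rule Phi_comp[OF hit_Phi])
  have "T x \<in> avoiding T (A \<epsilon>) k \<longleftrightarrow> (\<forall>j\<in>{1..k}. (T ^^ j) x \<notin> A \<epsilon>)" for x
  proof -
    have "T x \<in> avoiding T (A \<epsilon>) k \<longleftrightarrow> (\<forall>j<k. (T ^^ Suc j) x \<notin> A \<epsilon>)"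
      by (simp add: avoiding_def funpow_swap1)
    also have "\<dots> \<longleftrightarrow> (\<forall>j\<in>Suc ` {..<k}. (T ^^ j) x \<notin> A \<epsilon>)"
      by (auto simp del: funpow.simps)
    finally show ?thesis by (simp add: image_Suc_lessThan)
  qed
  then have eq: "(\<lambda>x. indicator (A \<epsilon>) x * (indicator (first_entrance T (A \<epsilon>) k) \<circ> T) x)
      = (indicator ?return :: 'm \<Rightarrow> complex)"
    by (intro ext) (auto simp: indicator_def first_entrance_def funpow_swap1)
  have "\<nu> (?m ((L \<epsilon> ^^ k) (P\<^sub>0 (?m \<phi>\<^sub>0)))) = pair (?m \<phi>\<^sub>0) (indicator (first_entrance T (A \<epsilon>) k) \<circ> T)"
    by (simp only: pair_L_power_indicator(4)[OF e] P0_transfer[OF hit_Phi])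
  also have "\<dots> = pair \<phi>\<^sub>0 (indicator ?return)"
    by (simp only: pair_mult[OF e(1) gT] eq)
  also have "\<dots> = complex_of_real (measure \<mu>\<^sub>0 ?return)"
    using Phi_mult[OF e(1) gT] unfolding eq by (rule pair_phi0_indicator)
  also have "measure \<mu>\<^sub>0 ?return = \<Delta> \<epsilon> * return_ratio T \<mu>\<^sub>0 (A \<epsilon>) k"
    using pos by (simp add: return_ratio_def)
  finally have "complex_of_real (hitting \<epsilon> (Suc k))
      = complex_of_real (hitting \<epsilon> k - \<Delta> \<epsilon> * return_ratio T \<mu>\<^sub>0 (A \<epsilon>) k)"
    unfolding of_real_diff nu_L_power_phi0(2)[OF e, symmetric] L_power_phi0_Suc[OF e]
    by (simp add: linear_diff[OF mult_linear[OF e(1)]] linear_diff[OF nu_linear])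
  then have "hitting \<epsilon> (Suc k) = hitting \<epsilon> k - \<Delta> \<epsilon> * return_ratio T \<mu>\<^sub>0 (A \<epsilon>) k"
    by (simp only: of_real_eq_iff)
  then show ?case by (simp add: Suc algebra_simps)
qed

lemma return_ratio_nonneg: "0 \<le> return_ratio T \<mu>\<^sub>0 B k"
  by (simp add: return_ratio_def)

lemma hitting_le:
  assumes "\<epsilon> \<in> E" "\<epsilon> \<noteq> 0" "0 < \<Delta> \<epsilon>" shows "hitting \<epsilon> k \<le> \<Delta> \<epsilon>"
  unfolding hitting_eq_return_ratios[OF assms]
  using assms(3) by (simp add: mult_le_cancel_left1 sum_nonneg return_ratio_nonneg)

section \<open>Loss of memory\<close>

text \<open>The assumption on rare events, divided by \<open>\<parallel>1\<^sub>A \<phi>\<^sub>0\<parallel>\<close>. It makes the contributions of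
  centred parts comparable to \<open>\<mu>\<^sub>0(A)\<close>, and hence negligible once a small factor has been gained.\<close>

lemma rare_functional_relative:
  assumes e: "\<epsilon> \<in> E" and c: "0 \<le> c" and v: "norm v \<le> c * norm (mult_ind (A \<epsilon>) \<phi>\<^sub>0)"
  shows "cmod (\<nu> (mult_ind (A \<epsilon>) v)) \<le> K\<^sub>0 * c * \<Delta> \<epsilon>"
proof (cases "mult_ind (A \<epsilon>) \<phi>\<^sub>0 = 0")
  case True
  then have "v = 0" using v by simp
  then show ?thesis
    using linear_0[OF mult_linear[OF e]] linear_0[OF nu_linear] K0_nonneg c by simp
next
  case False
  let ?s = "norm (mult_ind (A \<epsilon>) \<phi>\<^sub>0)"
  have "cmod (\<nu> (mult_ind (A \<epsilon>) v)) * ?s \<le> K\<^sub>0 * norm v * \<Delta> \<epsilon>"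
    using rare[OF e, of v] by (simp add: nu_mult_phi0[OF e])
  also have "\<dots> \<le> K\<^sub>0 * (c * ?s) * \<Delta> \<epsilon>"
    using K0_nonneg v by (intro mult_right_mono mult_left_mono) auto
  finally have "cmod (\<nu> (mult_ind (A \<epsilon>) v)) * ?s \<le> (K\<^sub>0 * c * \<Delta> \<epsilon>) * ?s" by (simp add: mult_ac)
  then show ?thesis by (rule mult_right_le_imp_le) (use False in simp)
qed

lemma L_power_phi0_drift:
  assumes e: "\<epsilon> \<in> E" "\<epsilon> \<noteq> 0"
  shows "norm ((L \<epsilon> ^^ n) \<phi>\<^sub>0 - \<phi>\<^sub>0) \<le> real n * ((2 * D)\<^sup>2 * norm (mult_ind (A \<epsilon>) \<phi>\<^sub>0))"
proof (induction n)
  case (Suc n)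
  let ?h = "P\<^sub>0 (mult_ind (A \<epsilon>) \<phi>\<^sub>0)"
  have "norm ((L \<epsilon> ^^ n) ?h) \<le> 2 * D * (2 * D * norm (mult_ind (A \<epsilon>) \<phi>\<^sub>0))"
    using D_pos by (intro order_trans[OF L_power_bound[OF e(1)]] mult_left_mono P0_bound) auto
  moreover have "norm ((L \<epsilon> ^^ Suc n) \<phi>\<^sub>0 - \<phi>\<^sub>0) \<le> norm ((L \<epsilon> ^^ n) \<phi>\<^sub>0 - \<phi>\<^sub>0) + norm ((L \<epsilon> ^^ n) ?h)"
    unfolding L_power_phi0_Suc[OF e]
    using norm_triangle_ineq4[of "(L \<epsilon> ^^ n) \<phi>\<^sub>0 - \<phi>\<^sub>0" "(L \<epsilon> ^^ n) ?h"] by (simp add: algebra_simps)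
  ultimately show ?case using Suc by (simp add: algebra_simps power2_eq_square)
qed simp

text \<open>A block of \<open>m\<close> steps halves the centred part that is already there and adds at most the drift of
  \<open>\<phi>\<^sub>0\<close>, which is of the size of \<open>1\<^sub>A \<phi>\<^sub>0\<close>. The contributions of the successive blocks form a
  convergent geometric series; this makes the bound uniform in \<open>n\<close>, although \<open>n\<close> will be of order
  \<open>1 / \<Delta>\<close>.\<close>

lemma centered_part_uniformly_small:
  obtains C where "0 < C"
    "\<forall>\<^sub>F \<epsilon> in at 0 within E. \<forall>n. norm (centered ((L \<epsilon> ^^ n) \<phi>\<^sub>0)) \<le> C * norm (mult_ind (A \<epsilon>) \<phi>\<^sub>0)"
proof -
  obtain m\<^sub>0 where m\<^sub>0: "\<And>m. m\<^sub>0 \<le> m \<Longrightarrow> \<forall>\<^sub>F \<epsilon> in at 0 within E. \<forall>f. \<nu> f = 0 \<longrightarrow>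
      norm ((L \<epsilon> ^^ m) f) \<le> 1 / (2 * centering_norm) * norm f"
    using contraction_on_kernel[of "1 / (2 * centering_norm)"] centering_norm_pos by auto
  \<comment> \<open>A positive block length makes the induction below descend.\<close>
  define m where "m = Suc m\<^sub>0"
  define C where "C = 2 * (centering_norm * (real m * (2 * D)\<^sup>2))"
  have C_pos: "0 < C" using centering_norm_pos D_pos by (simp add: C_def m_def)
  have "\<forall>\<^sub>F \<epsilon> in at 0 within E. \<forall>f. \<nu> f = 0 \<longrightarrow> norm ((L \<epsilon> ^^ m) f) \<le> 1 / (2 * centering_norm) * norm f"
    by (rule m\<^sub>0) (simp add: m_def)
  with eventually_parameter have "\<forall>\<^sub>F \<epsilon> in at 0 within E. \<forall>n.
      norm (centered ((L \<epsilon> ^^ n) \<phi>\<^sub>0)) \<le> C * norm (mult_ind (A \<epsilon>) \<phi>\<^sub>0)"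
  proof eventually_elim
    case (elim \<epsilon>)
    then have e: "\<epsilon> \<in> E" "\<epsilon> \<noteq> 0" by auto
    let ?s = "norm (mult_ind (A \<epsilon>) \<phi>\<^sub>0)"
    have drift: "norm (centered ((L \<epsilon> ^^ n) \<phi>\<^sub>0)) \<le> C / 2 * ?s" if "n \<le> m" for n
    proof -
      have "norm (centered ((L \<epsilon> ^^ n) \<phi>\<^sub>0)) = norm (centered ((L \<epsilon> ^^ n) \<phi>\<^sub>0 - \<phi>\<^sub>0))"
        by (simp add: linear_diff[OF centered_linear] centered_phi0)
      also have "\<dots> \<le> centering_norm * (real n * ((2 * D)\<^sup>2 * ?s))"
        using centering_norm_pos by (intro order_trans[OF norm_centered] mult_left_mono L_power_phi0_drift[OF e]) auto
      also have "\<dots> \<le> centering_norm * (real m * ((2 * D)\<^sup>2 * ?s))"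
        using centering_norm_pos that by (intro mult_left_mono mult_right_mono) auto
      finally show ?thesis by (simp add: C_def mult_ac)
    qed
    have "norm (centered ((L \<epsilon> ^^ n) \<phi>\<^sub>0)) \<le> C * ?s" for n
    proof (induction n rule: less_induct)
      case (less n)
      show ?case
      proof (cases "n \<le> m")
        case True
        have "C / 2 * ?s \<le> C * ?s" using C_pos by (intro mult_right_mono) auto
        then show ?thesis using drift[OF True] by simp
      next
        case False
        let ?g = "(L \<epsilon> ^^ (n - m)) \<phi>\<^sub>0"
        have IH: "norm (centered ?g) \<le> C * ?s"
          using False by (intro less.IH) (simp add: m_def)
        have "(L \<epsilon> ^^ n) \<phi>\<^sub>0 = (L \<epsilon> ^^ m) ?g"
          using False by (simp flip: funpow_add[THEN fun_cong, unfolded comp_def])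
        also have "\<dots> = \<nu> ?g *\<^sub>C (L \<epsilon> ^^ m) \<phi>\<^sub>0 + (L \<epsilon> ^^ m) (centered ?g)"
          by (subst centered_decomp[of ?g])
             (simp add: linear_add[OF L_power_linear[OF e(1)]] L_power_scaleC[OF e(1)])
        finally have "centered ((L \<epsilon> ^^ n) \<phi>\<^sub>0)
            = \<nu> ?g *\<^sub>C centered ((L \<epsilon> ^^ m) \<phi>\<^sub>0) + centered ((L \<epsilon> ^^ m) (centered ?g))"
          by (simp add: linear_add[OF centered_linear] centered_scaleC)
        then have "norm (centered ((L \<epsilon> ^^ n) \<phi>\<^sub>0))
            \<le> cmod (\<nu> ?g) * norm (centered ((L \<epsilon> ^^ m) \<phi>\<^sub>0)) + norm (centered ((L \<epsilon> ^^ m) (centered ?g)))"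
          by (metis norm_triangle_ineq norm_scaleC)
        also have "\<dots> \<le> 1 * (C / 2 * ?s) + centering_norm * (1 / (2 * centering_norm) * (C * ?s))"
        proof (rule add_mono)
          show "cmod (\<nu> ?g) * norm (centered ((L \<epsilon> ^^ m) \<phi>\<^sub>0)) \<le> 1 * (C / 2 * ?s)"
            unfolding nu_L_power_phi0(1)[OF e]
            using drift[of m] survival_le_1 by (intro mult_mono) auto
          have "norm ((L \<epsilon> ^^ m) (centered ?g)) \<le> 1 / (2 * centering_norm) * norm (centered ?g)"
            using elim nu_centered by blast
          also have "\<dots> \<le> 1 / (2 * centering_norm) * (C * ?s)"
            using centering_norm_pos by (intro mult_left_mono IH) auto
          finally show "norm (centered ((L \<epsilon> ^^ m) (centered ?g))) \<le> centering_norm * (1 / (2 * centering_norm) * (C * ?s))"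
            using centering_norm_pos by (intro order_trans[OF norm_centered] mult_left_mono) auto
        qed
        also have "\<dots> = C * ?s" using centering_norm_pos by simp
        finally show ?thesis .
      qed
    qed
    then show ?case by blast
  qed
  with C_pos show ?thesis by (rule that)
qed

text \<open>The centred part of \<open>P\<^sub>\<epsilon>\<^sup>n\<^sup>-\<^sup>k \<phi>\<^sub>0\<close> is forgotten during the last \<open>k\<close> steps. The rest is a multiple
  of \<open>\<phi>\<^sub>0\<close>, from which a first entrance after exactly \<open>k\<close> steps has the probability \<open>hitting \<epsilon> k\<close>.\<close>

lemma hitting_factorises:
  assumes "0 < \<sigma>"
  shows "\<exists>k\<^sub>0. \<forall>k\<ge>k\<^sub>0. \<forall>\<^sub>F \<epsilon> in at 0 within E. \<forall>n\<ge>k.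
    \<bar>hitting \<epsilon> n - survival \<epsilon> (n - k) * hitting \<epsilon> k\<bar> \<le> \<sigma> * \<Delta> \<epsilon>"
proof -
  obtain C where C: "0 < C"
    "\<forall>\<^sub>F \<epsilon> in at 0 within E. \<forall>n. norm (centered ((L \<epsilon> ^^ n) \<phi>\<^sub>0)) \<le> C * norm (mult_ind (A \<epsilon>) \<phi>\<^sub>0)"
    by (rule centered_part_uniformly_small) blast
  define \<tau> where "\<tau> = \<sigma> / ((K\<^sub>0 + 1) * C)"
  have tau: "0 < \<tau>" using assms C(1) K0_nonneg by (simp add: \<tau>_def)
  have tau_le: "K\<^sub>0 * (\<tau> * C) \<le> \<sigma>"
    using assms C(1) K0_nonneg by (simp add: \<tau>_def divide_simps mult_left_mono)
  obtain k\<^sub>0 where k\<^sub>0: "\<And>k. k\<^sub>0 \<le> k \<Longrightarrow>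
      \<forall>\<^sub>F \<epsilon> in at 0 within E. \<forall>f. \<nu> f = 0 \<longrightarrow> norm ((L \<epsilon> ^^ k) f) \<le> \<tau> * norm f"
    using contraction_on_kernel[OF tau] by blast
  have "\<forall>\<^sub>F \<epsilon> in at 0 within E. \<forall>n\<ge>k. \<bar>hitting \<epsilon> n - survival \<epsilon> (n - k) * hitting \<epsilon> k\<bar> \<le> \<sigma> * \<Delta> \<epsilon>"
    if "k\<^sub>0 \<le> k" for k
    using k\<^sub>0[OF that] C(2) eventually_parameter
  proof eventually_elim
    case (elim \<epsilon>)
    then have e: "\<epsilon> \<in> E" "\<epsilon> \<noteq> 0" by auto
    let ?s = "norm (mult_ind (A \<epsilon>) \<phi>\<^sub>0)" and ?m = "mult_ind (A \<epsilon>)"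
    show ?case
    proof (intro allI impI)
      fix n assume n: "k \<le> n"
      let ?g = "(L \<epsilon> ^^ (n - k)) \<phi>\<^sub>0"
      have "(L \<epsilon> ^^ n) \<phi>\<^sub>0 = (L \<epsilon> ^^ k) ?g"
        using n by (simp flip: funpow_add[THEN fun_cong, unfolded comp_def])
      also have "\<dots> = \<nu> ?g *\<^sub>C (L \<epsilon> ^^ k) \<phi>\<^sub>0 + (L \<epsilon> ^^ k) (centered ?g)"
        by (subst centered_decomp[of ?g])
           (simp add: linear_add[OF L_power_linear[OF e(1)]] L_power_scaleC[OF e(1)])
      finally have "\<nu> (?m ((L \<epsilon> ^^ n) \<phi>\<^sub>0))
          = \<nu> ?g * \<nu> (?m ((L \<epsilon> ^^ k) \<phi>\<^sub>0)) + \<nu> (?m ((L \<epsilon> ^^ k) (centered ?g)))"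
        by (simp add: linear_add[OF mult_linear[OF e(1)]] clinear_scaleC[OF mult_clinear[OF e(1)]]
            linear_add[OF nu_linear] nu_scaleC)
      then have "complex_of_real (hitting \<epsilon> n - survival \<epsilon> (n - k) * hitting \<epsilon> k)
          = \<nu> (?m ((L \<epsilon> ^^ k) (centered ?g)))"
        by (simp add: nu_L_power_phi0[OF e])
      then have "\<bar>hitting \<epsilon> n - survival \<epsilon> (n - k) * hitting \<epsilon> k\<bar>
          = cmod (\<nu> (?m ((L \<epsilon> ^^ k) (centered ?g))))"
        by (metis norm_of_real)
      also have "\<dots> \<le> K\<^sub>0 * (\<tau> * C) * \<Delta> \<epsilon>"
      proof (rule rare_functional_relative[OF e(1)])
        have "norm ((L \<epsilon> ^^ k) (centered ?g)) \<le> \<tau> * norm (centered ?g)"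
          using elim nu_centered by blast
        also have "\<dots> \<le> \<tau> * (C * ?s)" using elim tau by (intro mult_left_mono) auto
        finally show "norm ((L \<epsilon> ^^ k) (centered ?g)) \<le> \<tau> * C * ?s" by simp
      qed (use tau C(1) in simp)
      also have "\<dots> \<le> \<sigma> * \<Delta> \<epsilon>" by (intro mult_right_mono tau_le) simp
      finally show "\<bar>hitting \<epsilon> n - survival \<epsilon> (n - k) * hitting \<epsilon> k\<bar> \<le> \<sigma> * \<Delta> \<epsilon>" .
    qed
  qed
  then show ?thesis by blast
qed

text \<open>The initial densities \<open>1\<close> and \<open>\<phi>\<^sub>0\<close> differ by an element of the kernel of \<open>\<nu>\<close>, which is forgotten
  as well. Hence the reference measure may be replaced by the invariant measure.\<close>

lemma initial_measure_forgotten: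
  assumes "0 < \<sigma>"
  shows "\<exists>k. \<forall>\<^sub>F \<epsilon> in at 0 within E. \<forall>n\<ge>k.
    \<bar>measure \<nu>\<^sub>0 (avoiding T (A \<epsilon>) n) - survival \<epsilon> n\<bar> \<le> \<sigma>"
proof -
  let ?u = "one - \<phi>\<^sub>0"
  have u: "\<nu> ?u = 0" by (simp add: linear_diff[OF nu_linear] nu_one nu_phi0)
  define \<tau> where "\<tau> = \<sigma> / (N * (2 * D) * (1 + norm ?u))"
  have den: "0 < N * (2 * D) * (1 + norm ?u)" using N_pos D_pos by (simp add: add_pos_nonneg)
  have tau: "0 < \<tau>" using assms den by (simp add: \<tau>_def)
  have tau_le: "N * (2 * D * (\<tau> * norm ?u)) \<le> \<sigma>"
  proof -
    have "N * (2 * D * (\<tau> * norm ?u)) \<le> N * (2 * D * (\<tau> * (1 + norm ?u)))"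
      using N_pos D_pos tau by simp
    also have "\<dots> = \<tau> * (N * (2 * D) * (1 + norm ?u))" by (simp only: mult_ac)
    also have "\<dots> = \<sigma>" using den by (metis \<tau>_def less_irrefl nonzero_eq_divide_eq)
    finally show ?thesis .
  qed
  obtain k where "\<forall>\<^sub>F \<epsilon> in at 0 within E. \<forall>f. \<nu> f = 0 \<longrightarrow> norm ((L \<epsilon> ^^ k) f) \<le> \<tau> * norm f"
    using contraction_on_kernel[OF tau] by blast
  with eventually_parameter have "\<forall>\<^sub>F \<epsilon> in at 0 within E. \<forall>n\<ge>k.
    \<bar>measure \<nu>\<^sub>0 (avoiding T (A \<epsilon>) n) - survival \<epsilon> n\<bar> \<le> \<sigma>"
  proof eventually_elim
    case (elim \<epsilon>)
    then have e: "\<epsilon> \<in> E" "\<epsilon> \<noteq> 0" by auto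
    show ?case
    proof (intro allI impI)
      fix n assume n: "k \<le> n"
      have "complex_of_real (measure \<nu>\<^sub>0 (avoiding T (A \<epsilon>) n) - survival \<epsilon> n) = \<nu> ((L \<epsilon> ^^ n) ?u)"
        by (simp add: linear_diff[OF L_power_linear[OF e(1)]] linear_diff[OF nu_linear]
            nu_L_power_phi0[OF e] pair_L_power_indicator(2)[OF e, of n one]
            pair_one_indicator[OF pair_L_power_indicator(1)[OF e]])
      then have "\<bar>measure \<nu>\<^sub>0 (avoiding T (A \<epsilon>) n) - survival \<epsilon> n\<bar> = cmod (\<nu> ((L \<epsilon> ^^ n) ?u))"
        by (metis norm_of_real)
      also have "(L \<epsilon> ^^ n) ?u = (L \<epsilon> ^^ (n - k)) ((L \<epsilon> ^^ k) ?u)"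
        using n by (simp flip: funpow_add[THEN fun_cong, unfolded comp_def])
      also have "cmod (\<nu> \<dots>) \<le> N * (2 * D * norm ((L \<epsilon> ^^ k) ?u))"
        using N_pos by (intro order_trans[OF functional_bound] mult_left_mono L_power_bound e) auto
      also have "\<dots> \<le> N * (2 * D * (\<tau> * norm ?u))"
        using N_pos D_pos elim u by (intro mult_left_mono) auto
      finally show "\<bar>measure \<nu>\<^sub>0 (avoiding T (A \<epsilon>) n) - survival \<epsilon> n\<bar> \<le> \<sigma>" using tau_le by linarith
    qed
  qed
  then show ?thesis by blast
qed

end


section \<open>The limit of the survival probabilities\<close>

context REPFO_constants
begin

text \<open>The survival probabilities satisfy \<open>a\<^sub>j\<^sub>+\<^sub>1 = (1 - \<Delta> \<theta>) a\<^sub>j\<close> up to an error that is small compared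
  to \<open>\<Delta>\<close>, except for \<open>j < k\<close> with a fixed \<open>k\<close>, where it is at most \<open>\<Delta>\<close>. As \<open>n \<Delta>\<close> is bounded, the
  accumulated error up to time \<open>n\<close> is small.\<close>

theorem survival_limit:
  fixes e :: "nat \<Rightarrow> real" and q :: "nat \<Rightarrow> real"
  assumes e: "filterlim e (at 0 within E) sequentially"
    and t: "0 < t" and lim: "(\<lambda>n. real n * \<Delta> (e n)) \<longlonglongrightarrow> t"
    and q: "\<And>k. (\<lambda>n. return_ratio T \<mu>\<^sub>0 (A (e n)) k) \<longlonglongrightarrow> q k"
  shows "(\<lambda>n. measure \<nu>\<^sub>0 (avoiding T (A (e n)) n)) \<longlonglongrightarrow> exp (- t * (1 - (\<Sum>k. q k)))"
proof -
  define \<theta> where "\<theta> = 1 - (\<Sum>k. q k)"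
  define d where "d n = \<Delta> (e n)" for n
  note along = eventually_compose_filterlim[OF _ e]
  have param: "\<forall>\<^sub>F n in sequentially. e n \<in> E \<and> e n \<noteq> 0"
    by (rule along[OF eventually_parameter])
  have d_nonneg: "0 \<le> d n" and d_le_1: "d n \<le> 1" for n
    by (simp_all add: d_def prob_space.prob_le_1[OF prob_mu0])
  have d_pos: "\<forall>\<^sub>F n in sequentially. 0 < d n"
    using order_tendstoD(1)[OF lim t]
  proof eventually_elim
    case (elim n)
    then show ?case using d_nonneg[of n] by (auto simp: d_def zero_less_mult_iff)
  qed
  have nd_bounded: "\<forall>\<^sub>F n in sequentially. real n * d n < t + 1"
    using order_tendstoD(2)[OF lim, of "t + 1"] by (simp add: d_def)
  have d_lim: "d \<longlonglongrightarrow> 0"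
  proof (rule Lim_transform_eventually)
    show "(\<lambda>n. real n * \<Delta> (e n) * inverse (real n)) \<longlonglongrightarrow> 0"
      using tendsto_mult[OF lim lim_inverse_n] by simp
    show "\<forall>\<^sub>F n in sequentially. real n * \<Delta> (e n) * inverse (real n) = d n"
      using eventually_gt_at_top[of 0] by eventually_elim (simp add: d_def)
  qed
  have hit_eq: "\<forall>\<^sub>F n in sequentially. \<forall>k.
      hitting (e n) k = d n * (1 - (\<Sum>j<k. return_ratio T \<mu>\<^sub>0 (A (e n)) j))"
    using param d_pos by eventually_elim (simp add: hitting_eq_return_ratios d_def)

  have q_nonneg: "0 \<le> q k" for k
    by (rule LIMSEQ_le_const[OF q]) (auto simp: return_ratio_nonneg)
  have q_sum: "(\<Sum>j<k. q j) \<le> 1" for k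
  proof (rule tendsto_upperbound)
    show "(\<lambda>n. \<Sum>j<k. return_ratio T \<mu>\<^sub>0 (A (e n)) j) \<longlonglongrightarrow> (\<Sum>j<k. q j)"
      by (intro tendsto_sum q)
    show "\<forall>\<^sub>F n in sequentially. (\<Sum>j<k. return_ratio T \<mu>\<^sub>0 (A (e n)) j) \<le> 1"
      using hit_eq d_pos
    proof eventually_elim
      case (elim n)
      then have "0 \<le> d n * (1 - (\<Sum>j<k. return_ratio T \<mu>\<^sub>0 (A (e n)) j))"
        by (metis measure_nonneg)
      then show ?case using elim by (simp add: zero_le_mult_iff)
    qed
  qed simp
  have summable: "summable q" by (rule summableI_nonneg_bounded[OF q_nonneg q_sum])
  have theta: "0 \<le> \<theta>" "\<theta> \<le> 1"
    using suminf_le_const[OF summable q_sum] suminf_nonneg[OF summable q_nonneg]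
    by (simp_all add: \<theta>_def)
  have partial: "(\<lambda>k. 1 - (\<Sum>j<k. q j)) \<longlonglongrightarrow> \<theta>"
    unfolding \<theta>_def by (intro tendsto_diff tendsto_const summable_LIMSEQ summable)

  have surv: "\<forall>\<^sub>F n in sequentially. \<bar>survival (e n) n - (1 - d n * \<theta>) ^ n\<bar> \<le> \<sigma> * (4 * t + 5)"
    if \<sigma>: "0 < \<sigma>" for \<sigma>
  proof -
    obtain k\<^sub>0 where k\<^sub>0: "\<And>k. k\<^sub>0 \<le> k \<Longrightarrow> \<forall>\<^sub>F \<epsilon> in at 0 within E. \<forall>n\<ge>k.
        \<bar>hitting \<epsilon> n - survival \<epsilon> (n - k) * hitting \<epsilon> k\<bar> \<le> \<sigma> * \<Delta> \<epsilon>"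
      using hitting_factorises[OF \<sigma>] by blast
    have "\<forall>\<^sub>F k in sequentially. \<bar>1 - (\<Sum>j<k. q j) - \<theta>\<bar> < \<sigma>"
      using tendstoD[OF partial \<sigma>] by (simp add: dist_real_def)
    then obtain k where k: "k\<^sub>0 \<le> k" "\<bar>1 - (\<Sum>j<k. q j) - \<theta>\<bar> < \<sigma>"
      unfolding eventually_sequentially by (meson nle_le)
    have "(\<lambda>n. 1 - (\<Sum>j<k. return_ratio T \<mu>\<^sub>0 (A (e n)) j)) \<longlonglongrightarrow> 1 - (\<Sum>j<k. q j)"
      by (intro tendsto_intros q)
    from tendstoD[OF this \<sigma>]
    have ratio: "\<forall>\<^sub>F n in sequentially.
        \<bar>1 - (\<Sum>j<k. return_ratio T \<mu>\<^sub>0 (A (e n)) j) - (1 - (\<Sum>j<k. q j))\<bar> < \<sigma>"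
      by (simp only: dist_real_def)
    have "(\<lambda>n. real k * d n) \<longlonglongrightarrow> real k * 0" by (intro tendsto_intros d_lim)
    then have kd: "\<forall>\<^sub>F n in sequentially. real k * d n < \<sigma>"
      using \<sigma> by (intro order_tendstoD(2)) auto
    show ?thesis
      using along[OF k\<^sub>0[OF k(1)]] param d_pos hit_eq ratio kd nd_bounded
    proof eventually_elim
      case (elim n)
      then have en: "e n \<in> E" "e n \<noteq> 0" "0 < \<Delta> (e n)" by (auto simp: d_def)
      define a where "a = survival (e n)"
      define b where "b = hitting (e n)"
      define r where "r = 1 - (\<Sum>j<k. return_ratio T \<mu>\<^sub>0 (A (e n)) j)"
      have a_Suc: "a (Suc j) = a j - b j" for j
        using survival_Suc[OF en(1,2)] by (simp add: a_def b_def)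
      have a: "0 \<le> a j" "a j \<le> 1" for j by (simp_all add: a_def survival_le_1)
      have b: "0 \<le> b j" "b j \<le> d n" for j using hitting_le[OF en] by (simp_all add: b_def d_def)
      have bk: "b k = d n * r" using elim by (simp add: b_def r_def)
      have r: "\<bar>r - \<theta>\<bar> \<le> 2 * \<sigma>" using elim k(2) by (simp add: r_def)
      have recent: "\<bar>a j - a (j - i)\<bar> \<le> real i * d n" if "i \<le> j" for i j
        using that
      proof (induction i)
        case (Suc i)
        then have "a (j - i) = a (j - Suc i) - b (j - Suc i)"
          using a_Suc[of "j - Suc i"] by (simp add: Suc_diff_Suc)
        then show ?case using Suc b[of "j - Suc i"] by (simp add: algebra_simps)
      qed simp
      \<comment> \<open>Three replacements: \<open>b j\<close> by its factorised form, the ratio \<open>r\<close> by its limit \<open>\<theta>\<close>, and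
        \<open>a (j - k)\<close> by \<open>a j\<close>.\<close>
      have late: "\<bar>a (Suc j) - (1 - d n * \<theta>) * a j\<bar> \<le> 4 * \<sigma> * d n" if "k \<le> j" for j
      proof -
        have "\<bar>b j - a (j - k) * (d n * r)\<bar> \<le> \<sigma> * d n"
          using elim that bk by (simp add: a_def b_def d_def)
        moreover have "\<bar>a (j - k) * (d n * (r - \<theta>))\<bar> \<le> 1 * (d n * (2 * \<sigma>))"
          unfolding abs_mult using a[of "j - k"] d_nonneg[of n] r by (intro mult_mono) auto
        moreover have "\<bar>(a (j - k) - a j) * (d n * \<theta>)\<bar> \<le> \<sigma> * (d n * 1)"
          unfolding abs_mult using recent[OF that] elim theta d_nonneg[of n]
          by (intro mult_mono) (auto simp: abs_minus_commute)
        moreover have "a (Suc j) - (1 - d n * \<theta>) * a j = - (b j - a (j - k) * (d n * r))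
            - a (j - k) * (d n * (r - \<theta>)) - (a (j - k) - a j) * (d n * \<theta>)"
          by (simp add: a_Suc algebra_simps)
        ultimately show ?thesis by (simp add: algebra_simps)
      qed
      have early: "\<bar>a (Suc j) - (1 - d n * \<theta>) * a j\<bar> \<le> d n" for j
      proof -
        have "0 \<le> d n * \<theta> * a j" using d_nonneg theta a by simp
        moreover have "d n * \<theta> * a j \<le> d n * 1 * 1"
          using d_nonneg theta a by (intro mult_mono) auto
        ultimately show ?thesis using b[of j] by (simp add: a_Suc algebra_simps)
      qed
      have "\<bar>a n - (1 - d n * \<theta>) ^ n\<bar> \<le> (\<Sum>j<n. \<bar>a (Suc j) - (1 - d n * \<theta>) * a j\<bar>)"
        using theta d_nonneg[of n] d_le_1[of n] mult_mono[of "d n" 1 \<theta> 1]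
        by (intro distance_to_geometric) (auto simp: a_def survival_0)
      also have "\<dots> \<le> (\<Sum>j<n. (if j < k then d n else 0) + 4 * \<sigma> * d n)"
      proof (rule sum_mono)
        fix j
        have "0 \<le> 4 * \<sigma> * d n" using \<sigma> d_nonneg[of n] by simp
        then show "\<bar>a (Suc j) - (1 - d n * \<theta>) * a j\<bar> \<le> (if j < k then d n else 0) + 4 * \<sigma> * d n"
          using late[of j] early[of j] by auto
      qed
      also have "\<dots> = (\<Sum>j\<in>{..<n} \<inter> {..<k}. d n) + 4 * \<sigma> * (real n * d n)"
        by (simp add: sum.distrib sum.If_cases lessThan_def Collect_conj_eq)
      also have "\<dots> \<le> real k * d n + 4 * \<sigma> * (t + 1)"
      proof (intro add_mono mult_left_mono)
        have "real (card ({..<n} \<inter> {..<k})) \<le> real k"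
          using card_mono[of "{..<k}" "{..<n} \<inter> {..<k}"] by simp
        then show "(\<Sum>j\<in>{..<n} \<inter> {..<k}. d n) \<le> real k * d n"
          using d_nonneg[of n] by (simp add: mult_right_mono)
      qed (use elim \<sigma> in auto)
      also have "\<dots> \<le> \<sigma> + 4 * \<sigma> * (t + 1)" using elim by simp
      finally show ?case by (simp add: a_def algebra_simps)
    qed
  qed
  have "(\<lambda>n. survival (e n) n - (1 - d n * \<theta>) ^ n) \<longlonglongrightarrow> 0"
  proof (rule tendstoI)
    fix x :: real assume x: "0 < x"
    have "0 < x / (2 * (4 * t + 5))" using x t by simp
    from surv[OF this] show "\<forall>\<^sub>F n in sequentially. dist (survival (e n) n - (1 - d n * \<theta>) ^ n) 0 < x"
    proof eventually_elim
      case (elim n)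
      have "x / (2 * (4 * t + 5)) * (4 * t + 5) = x / 2" using t by (simp add: field_simps)
      then show ?case using elim x unfolding dist_real_def diff_0_right by linarith
    qed
  qed
  moreover have "(\<lambda>n. measure \<nu>\<^sub>0 (avoiding T (A (e n)) n) - survival (e n) n) \<longlonglongrightarrow> 0"
  proof (rule tendstoI)
    fix x :: real assume x: "0 < x"
    obtain k where "\<forall>\<^sub>F \<epsilon> in at 0 within E. \<forall>n\<ge>k. \<bar>measure \<nu>\<^sub>0 (avoiding T (A \<epsilon>) n) - survival \<epsilon> n\<bar> \<le> x / 2"
      using initial_measure_forgotten[of "x / 2"] x by auto
    from along[OF this] eventually_ge_at_top[of k]
    show "\<forall>\<^sub>F n in sequentially. dist (measure \<nu>\<^sub>0 (avoiding T (A (e n)) n) - survival (e n) n) 0 < x"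
    proof eventually_elim
      case (elim n)
      then have "\<bar>measure \<nu>\<^sub>0 (avoiding T (A (e n)) n) - survival (e n) n\<bar> \<le> x / 2" by blast
      then show ?case using x by (simp add: dist_real_def)
    qed
  qed
  moreover have "(\<lambda>n. (1 - d n * \<theta>) ^ n - (1 + (- t * \<theta>) / real n) ^ n) \<longlonglongrightarrow> 0"
  proof (rule Lim_null_comparison)
    obtain m :: nat where m: "t < real m" using reals_Archimedean2 by blast
    show "\<forall>\<^sub>F n in sequentially. norm ((1 - d n * \<theta>) ^ n - (1 + (- t * \<theta>) / real n) ^ n)
        \<le> \<theta> * \<bar>real n * d n - t\<bar>"
      using eventually_gt_at_top[of m]
    proof eventually_elim
      case (elim n)
      then have n: "0 < real n" "t \<le> real n" using m by auto
      have "0 \<le> d n * \<theta>" "d n * \<theta> \<le> 1"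
        using theta d_nonneg[of n] d_le_1[of n] mult_mono[of "d n" 1 \<theta> 1] by auto
      then have x: "norm (1 - d n * \<theta>) \<le> 1" by simp
      have "t * \<theta> \<le> real n * 1" using theta t n by (intro mult_mono) auto
      then have y: "norm (1 + (- t * \<theta>) / real n) \<le> 1"
        using n theta t by (simp add: abs_if field_simps)
      have "norm ((1 - d n * \<theta>) ^ n - (1 + (- t * \<theta>) / real n) ^ n)
          \<le> real n * \<bar>(1 - d n * \<theta>) - (1 + (- t * \<theta>) / real n)\<bar>"
        using norm_power_diff[OF x y] by simp
      also have "\<dots> = \<bar>real n * ((1 - d n * \<theta>) - (1 + (- t * \<theta>) / real n))\<bar>"
        by (simp add: abs_mult)
      also have "real n * ((1 - d n * \<theta>) - (1 + (- t * \<theta>) / real n)) = \<theta> * - (real n * d n - t)"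
        using n by (simp add: field_simps)
      also have "\<bar>\<dots>\<bar> = \<theta> * \<bar>real n * d n - t\<bar>"
        unfolding abs_mult abs_minus_cancel using theta by simp
      finally show ?case .
    qed
    have "(\<lambda>n. \<theta> * \<bar>real n * d n - t\<bar>) \<longlonglongrightarrow> \<theta> * \<bar>t - t\<bar>"
      unfolding d_def by (intro tendsto_intros lim)
    then show "(\<lambda>n. \<theta> * \<bar>real n * d n - t\<bar>) \<longlonglongrightarrow> 0" by simp
  qed
  moreover have "(\<lambda>n. (1 + (- t * \<theta>) / real n) ^ n) \<longlonglongrightarrow> exp (- t * \<theta>)"
    by (rule tendsto_exp_limit_sequentially)
  ultimately have "(\<lambda>n. (measure \<nu>\<^sub>0 (avoiding T (A (e n)) n) - survival (e n) n)
      + (survival (e n) n - (1 - d n * \<theta>) ^ n)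
      + ((1 - d n * \<theta>) ^ n - (1 + (- t * \<theta>) / real n) ^ n)
      + (1 + (- t * \<theta>) / real n) ^ n) \<longlonglongrightarrow> 0 + 0 + 0 + exp (- t * \<theta>)"
    by (intro tendsto_add)
  then show ?thesis by (simp add: \<theta>_def)
qed

end

lemma (in REPFO) constants_exist:
  "\<exists>\<alpha> D K\<^sub>0 N wnorm \<pi>. REPFO_constants T \<nu>\<^sub>0 \<Phi> pair one P\<^sub>0 \<phi>\<^sub>0 Q\<^sub>0 \<mu>\<^sub>0 mult_ind E A \<alpha> D K\<^sub>0 N wnorm \<pi>"
proof -
  obtain K\<^sub>0 where K0: "\<And>f \<epsilon>. \<epsilon> \<in> E \<Longrightarrow>
      cmod (functional_of pair (mult_ind (A \<epsilon>) f)) * norm (mult_ind (A \<epsilon>) \<phi>\<^sub>0)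
        \<le> K\<^sub>0 * norm f * cmod (functional_of pair (mult_ind (A \<epsilon>) \<phi>\<^sub>0))"
    using rare_bound by blast
  have rare: "cmod (functional_of pair (mult_ind (A \<epsilon>) f)) * norm (mult_ind (A \<epsilon>) \<phi>\<^sub>0)
        \<le> max K\<^sub>0 0 * norm f * cmod (functional_of pair (mult_ind (A \<epsilon>) \<phi>\<^sub>0))" if "\<epsilon> \<in> E" for f \<epsilon>
    by (rule order_trans[OF K0[OF that]]) (intro mult_right_mono; simp)
  obtain N where N: "0 < N" "\<And>f. cmod (functional_of pair f) \<le> N * norm f"
    by (rule bounded_clinear_pos_bound[OF nu0_bounded]) blast
  from uniform_estimates obtain \<alpha> D wnorm \<pi> where
    "0 < \<alpha>" "\<alpha> < 1" "0 < D" "cseminorm wnorm" "\<forall>f. wnorm f \<le> norm f"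
    "\<forall>\<epsilon>\<in>E. \<forall>f. \<forall>n::nat. wnorm ((rare_op P\<^sub>0 mult_ind A \<epsilon> ^^ n) f) \<le> D * wnorm f"
    "\<forall>\<epsilon>\<in>E. \<forall>f. \<forall>n::nat. norm ((rare_op P\<^sub>0 mult_ind A \<epsilon> ^^ n) f) \<le> D * \<alpha> ^ n * norm f + D * wnorm f"
    "\<forall>\<epsilon>\<in>E. 0 \<le> \<pi> \<epsilon>" "(\<pi> \<longlongrightarrow> 0) (at 0 within E)"
    "\<forall>\<epsilon>\<in>E. \<forall>f. wnorm (rare_op P\<^sub>0 mult_ind A \<epsilon> f - P\<^sub>0 f) \<le> \<pi> \<epsilon> * norm f"
    by auto
  then have "REPFO_constants T \<nu>\<^sub>0 \<Phi> pair one P\<^sub>0 \<phi>\<^sub>0 Q\<^sub>0 \<mu>\<^sub>0 mult_ind E A \<alpha> D (max K\<^sub>0 0) N wnorm \<pi>"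
    by unfold_locales (use rare N in auto)
  then show ?thesis by blast
qed


section \<open>The distribution of maxima\<close>

theorem mainTheorem3:
  fixes T :: "'m::metric_space \<Rightarrow> 'm"
    and \<nu>\<^sub>0 \<mu>\<^sub>0 :: "'m measure"
    and \<Phi> :: "('m \<Rightarrow> complex) set"
    and pair :: "'v::complex_banach \<Rightarrow> ('m \<Rightarrow> complex) \<Rightarrow> complex"
    and one \<phi>\<^sub>0 :: 'v
    and P\<^sub>0 Q\<^sub>0 :: "'v \<Rightarrow> 'v"
    and mult_ind :: "'m set \<Rightarrow> 'v \<Rightarrow> 'v"
    and X :: "'m \<Rightarrow> real"
    and zmax z0 t \<theta> :: real
    and q z :: "nat \<Rightarrow> real"
  assumes X_cont: "continuous_on UNIV X"
    and zmax_finite: "bdd_above {y. measure \<nu>\<^sub>0 {x. y \<le> X x} > 0}"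
    and zmax: "zmax = Sup {y. measure \<nu>\<^sub>0 {x. y \<le> X x} > 0}"
    and z0: "z0 < zmax"
    and REPFO: "REPFO T \<nu>\<^sub>0 \<Phi> pair one P\<^sub>0 \<phi>\<^sub>0 Q\<^sub>0 \<mu>\<^sub>0 mult_ind
                  {0..zmax - z0} (\<lambda>\<epsilon>. {x. X x > zmax - \<epsilon>})"
    and null: "measure \<nu>\<^sub>0 {x. X x > zmax} = 0"
    and pos: "\<And>\<epsilon>. \<epsilon> \<in> {0..zmax - z0} \<Longrightarrow> \<epsilon> > 0 \<Longrightarrow> measure \<mu>\<^sub>0 {x. X x > zmax - \<epsilon>} > 0"
    and q_lim: "\<And>k. ((\<lambda>\<epsilon>. return_ratio T \<mu>\<^sub>0 {x. X x > zmax - \<epsilon>} k) \<longlongrightarrow> q k)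
                      (at 0 within {0..zmax - z0})"
    and theta: "\<theta> = 1 - (\<Sum>k. q k)"
    and t: "t > 0"
    and z_range: "\<And>n. z n \<in> {z0..zmax}"
    and z_lim: "(\<lambda>n. real n * measure \<mu>\<^sub>0 {x. X x > z n}) \<longlonglongrightarrow> t"
  shows "(\<lambda>n. measure \<nu>\<^sub>0 {x. (MAX k\<in>{..<n}. X ((T ^^ k) x)) \<le> z n})
           \<longlonglongrightarrow> exp (- t * \<theta>)"
proof -
  obtain \<alpha> D K\<^sub>0 N wnorm \<pi> where "REPFO_constants T \<nu>\<^sub>0 \<Phi> pair one P\<^sub>0 \<phi>\<^sub>0 Q\<^sub>0 \<mu>\<^sub>0 mult_ind
      {0..zmax - z0} (\<lambda>\<epsilon>. {x. X x > zmax - \<epsilon>}) \<alpha> D K\<^sub>0 N wnorm \<pi>"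
    using REPFO.constants_exist[OF REPFO] by blast
  then interpret R: REPFO_constants T \<nu>\<^sub>0 \<Phi> pair one P\<^sub>0 \<phi>\<^sub>0 Q\<^sub>0 \<mu>\<^sub>0 mult_ind
      "{0..zmax - z0}" "\<lambda>\<epsilon>. {x. X x > zmax - \<epsilon>}" \<alpha> D K\<^sub>0 N wnorm \<pi> .
  define e where "e n = zmax - z n" for n
  have e_range: "e n \<in> {0..zmax - z0}" for n using z_range[of n] by (simp add: e_def)
  have level: "{x. X x > zmax - e n} = {x. X x > z n}" for n by (simp add: e_def)
  have mass_lim: "(\<lambda>n. measure \<mu>\<^sub>0 {x. X x > z n}) \<longlonglongrightarrow> 0"
  proof (rule Lim_transform_eventually)
    show "(\<lambda>n. real n * measure \<mu>\<^sub>0 {x. X x > z n} * inverse (real n)) \<longlonglongrightarrow> 0"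
      using tendsto_mult[OF z_lim lim_inverse_n] by simp
    show "\<forall>\<^sub>F n in sequentially. real n * measure \<mu>\<^sub>0 {x. X x > z n} * inverse (real n)
        = measure \<mu>\<^sub>0 {x. X x > z n}"
      using eventually_gt_at_top[of 0] by eventually_elim simp
  qed
  interpret mu0: prob_space \<mu>\<^sub>0 by (rule R.prob_mu0)
  have mono: "measure \<mu>\<^sub>0 {x. X x > y'} \<le> measure \<mu>\<^sub>0 {x. X x > y}" if "y \<le> y'" for y y'
  proof (rule mu0.finite_measure_mono)
    have "open {x. X x > y}" using X_cont by (intro open_Collect_less) auto
    then show "{x. X x > y} \<in> sets \<mu>\<^sub>0" by (simp add: R.sets_mu0)
  qed (use that in auto)
  have e_lim: "e \<longlonglongrightarrow> 0"
  proof (rule order_tendstoI)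
    fix c :: real assume "0 < c"
    define c' where "c' = min c (zmax - z0)"
    have c': "0 < c'" "c' \<le> c" "c' \<in> {0..zmax - z0}" using \<open>0 < c\<close> z0 by (auto simp: c'_def)
    have "\<forall>\<^sub>F n in sequentially. measure \<mu>\<^sub>0 {x. X x > z n} < measure \<mu>\<^sub>0 {x. X x > zmax - c'}"
      by (rule order_tendstoD(2)[OF mass_lim pos[OF c'(3,1)]])
    then show "\<forall>\<^sub>F n in sequentially. e n < c"
    proof eventually_elim
      case (elim n)
      then have "\<not> z n \<le> zmax - c'" using mono by (meson not_le)
      then show ?case using c' by (simp add: e_def)
    qed
  next
    fix c :: real assume "c < 0"
    then have "c < e n" for n using e_range[of n] by simp
    then show "\<forall>\<^sub>F n in sequentially. c < e n" by simp
  qed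
  \<comment> \<open>The operators for \<open>\<epsilon> = 0\<close> follow a different rule, so \<open>z n = zmax\<close> has to be excluded. The set
    \<open>{X > zmax}\<close> is contained in all \<open>{X > z n}\<close> and hence is \<open>\<mu>\<^sub>0\<close>-null, so that \<open>z n = zmax\<close> would
    give \<open>n \<mu>\<^sub>0{X > z n} = 0\<close>, which is far from \<open>t\<close> for large \<open>n\<close>.\<close>
  have e_nonzero: "\<forall>\<^sub>F n in sequentially. e n \<noteq> 0"
  proof -
    have "measure \<mu>\<^sub>0 {x. X x > zmax} \<le> 0"
      using mono[of "z n" zmax for n] z_range by (intro LIMSEQ_le_const[OF mass_lim]) auto
    then have zero: "measure \<mu>\<^sub>0 {x. X x > zmax} = 0" by (simp add: measure_le_0_iff)
    show ?thesis using order_tendstoD(1)[OF z_lim t]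
    proof eventually_elim
      case (elim n)
      then show ?case using zero by (auto simp: e_def)
    qed
  qed
  have e_filter: "filterlim e (at 0 within {0..zmax - z0}) sequentially"
    using e_lim e_nonzero e_range by (simp add: filterlim_at)
  have "(\<lambda>n. measure \<nu>\<^sub>0 (avoiding T {x. X x > zmax - e n} n)) \<longlonglongrightarrow> exp (- t * (1 - (\<Sum>k. q k)))"
  proof (rule R.survival_limit[OF e_filter t])
    show "(\<lambda>n. real n * measure \<mu>\<^sub>0 {x. X x > zmax - e n}) \<longlonglongrightarrow> t"
      using z_lim by (simp only: level)
    show "(\<lambda>n. return_ratio T \<mu>\<^sub>0 {x. X x > zmax - e n} k) \<longlonglongrightarrow> q k" for k
      by (rule filterlim_compose[OF q_lim e_filter])
  qed
  then have "(\<lambda>n. measure \<nu>\<^sub>0 (avoiding T {x. X x > z n} n)) \<longlonglongrightarrow> exp (- t * \<theta>)"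
    by (simp only: level theta)
  then show ?thesis
  proof (rule Lim_transform_eventually)
    show "\<forall>\<^sub>F n in sequentially. measure \<nu>\<^sub>0 (avoiding T {x. X x > z n} n)
        = measure \<nu>\<^sub>0 {x. (MAX k\<in>{..<n}. X ((T ^^ k) x)) \<le> z n}"
      using eventually_gt_at_top[of 0]
    proof eventually_elim
      case (elim n)
      have "avoiding T {x. X x > z n} n = {x. (MAX k\<in>{..<n}. X ((T ^^ k) x)) \<le> z n}"
        using elim by (subst Max_le_iff) (auto simp: avoiding_def not_less)
      then show ?case by simp
    qed
  qed
qed

end
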